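(* Let $B$ be a completely connected Bratteli diagram of infinite rank, and let $j\in\mathbb N\cup\{\infty\}$ be such that for $\mathbb P$-almost every order $\omega\in\mathcal O_B$ one has $|X_{\max}(\omega)|=j$ and $|X_{\min}(\omega)|=j$. If $j>1$, then $\mathbb P$-almost every order $\omega\in\mathcal O_B$ is imperfect.
   Context: A Bratteli diagram is an infinite graph $B=(V,E)$ (multiple edges allowed) with $V=\bigcup_{i\ge0}V_i$ and $E=\bigcup_{i\ge1}E_i$ partitioned into disjoint finite sets, $V_0=\{v_0\}$ a single point, with range and source maps $r,s:E\to V$ such that $r(E_i)=V_i$ and $s(E_i)=V_{i-1}$. The $n$-th incidence matrix $F_n=(f^{(n)}_{v,w})$, $n\ge0$, is the $|V_{n+1}|\times|V_n|$ matrix with $f^{(n)}_{v,w}=|\{e\in E_{n+1}: r(e)=v, s(e)=w\}|$. $B$ is completely connected if all entries of all incidence matrices are positive. $B$ has finite rank if for some $k$, $|V_n|\le k$ for all $n\ge1$; otherwise it has infinite rank. $X_B$ is the set of infinite paths $(e_i)_{i\ge1}$, $e_i\in E_i$, $r(e_i)=s(e_{i+1})$, starting at $v_0$, with the topology generated by the cylinder sets (sets of infinite paths having prescribed edges at finitely many consecutive levels). An order $\omega$ on $B$ is a choice of a linear order $\omega_v$ on $r^{-1}(v)$ for every $v\in V\setminus V_0$; $\mathcal O_B=\prod_{v\in V\setminus V_0}P_v$ is the set of all orders, where $P_v$ is the set of linear orders on $r^{-1}(v)$. A finite or infinite path is maximal (minimal) for $\omega$ if each of its edges $e_i$ is the maximal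 (minimal) element of $r^{-1}(r(e_i))$; $X_{\max}(\omega)$, $X_{\min}(\omega)\subset X_B$ are the sets of infinite maximal, resp. minimal, paths. Here $|X_{\max}(\omega)|=\infty$ means that $X_{\max}(\omega)$ is infinite, and likewise for $X_{\min}(\omega)$. $\mathbb P$ is the completion of the product measure $\prod_{v\in V\setminus V_0}\mathbb P_v$ on $\mathcal O_B$ (with the product $\sigma$-algebra), where $\mathbb P_v$ is the uniform probability measure on $P_v$. The successor map $s_\omega:X_B\setminus X_{\max}(\omega)\to X_B\setminus X_{\min}(\omega)$ is $s_\omega(x_1,x_2,\ldots)=(x_1^0,\ldots,x_{k-1}^0,\overline{x_k},x_{k+1},x_{k+2},\ldots)$, where $k=\min\{n\ge1: x_n\text{ is not maximal}\}$, $\overline{x_k}$ is the successor of $x_k$ in $r^{-1}(r(x_k))$, and $(x_1^0,\ldots,x_{k-1}^0)$ is the unique minimal path from $v_0$ to $s(\overline{x_k})$. A continuous Vershik map for $\omega$ is a homeomorphism $\varphi:X_B\to X_B$ with $\varphi(X_{\max}(\omega))=X_{\min}(\omega)$ and $\varphi(x)=s_\omega(x)$ for all $x\in X_B\setminus X_{\max}(\omega)$. The order $\omega$ is perfect if it admits a continuous Vershik map, and imperfect otherwise. *)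

theory Defs
  imports "HOL-Analysis.Analysis"
begin

text \<open>Only the edge sets with index at least 1 belong to a diagram; the value of \<open>edges_at\<close> at
  0 is irrelevant everywhere below. An edge in \<open>edges_at B (Suc n)\<close> runs from level \<open>n\<close> to level
  \<open>Suc n\<close>.\<close>

record ('v, 'e) bratteli =
  verts_at :: "nat \<Rightarrow> 'v set"
  edges_at :: "nat \<Rightarrow> 'e set"
  src :: "'e \<Rightarrow> 'v"
  rng :: "'e \<Rightarrow> 'v"

definition bratteli_diagram :: "('v, 'e) bratteli \<Rightarrow> bool" where
  "bratteli_diagram B \<longleftrightarrow>
     (\<forall>i. finite (verts_at B i)) \<and>
     (\<forall>i\<ge>1. finite (edges_at B i)) \<and>
     disjoint_family_on (verts_at B) UNIV \<and>
     disjoint_family_on (edges_at B) {1..} \<and>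
     (\<exists>v0. verts_at B 0 = {v0}) \<and>
     (\<forall>i\<ge>1. rng B ` edges_at B i = verts_at B i \<and> src B ` edges_at B i = verts_at B (i - 1))"

definition all_verts :: "('v, 'e) bratteli \<Rightarrow> 'v set" where
  "all_verts B = (\<Union>i. verts_at B i)"

definition all_edges :: "('v, 'e) bratteli \<Rightarrow> 'e set" where
  "all_edges B = (\<Union>i\<in>{1..}. edges_at B i)"

definition incidence :: "('v, 'e) bratteli \<Rightarrow> nat \<Rightarrow> 'v \<Rightarrow> 'v \<Rightarrow> nat" where
  "incidence B n v w = card {e \<in> edges_at B (n + 1). rng B e = v \<and> src B e = w}"

definition completely_connected :: "('v, 'e) bratteli \<Rightarrow> bool" where
  "completely_connected B \<longleftrightarrow>
     (\<forall>n. \<forall>v\<in>verts_at B (n + 1). \<forall>w\<in>verts_at B n. incidence B n v w > 0)"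

definition finite_rank :: "('v, 'e) bratteli \<Rightarrow> bool" where
  "finite_rank B \<longleftrightarrow> (\<exists>k. \<forall>n\<ge>1. card (verts_at B n) \<le> k)"

definition infinite_rank :: "('v, 'e) bratteli \<Rightarrow> bool" where
  "infinite_rank B \<longleftrightarrow> \<not> finite_rank B"


text \<open>A path is a sequence whose \<open>i\<close>-th edge lies in \<open>edges_at B i\<close>, for \<open>i \<ge> 1\<close>. Membership in
  \<open>PiE\<close> forces the value \<open>undefined\<close> at all other indices, so that distinct sequences are distinct
  paths. Paths start at the root automatically, as the source of every edge in \<open>edges_at B 1\<close> is in
  \<open>verts_at B 0\<close>.\<close>

definition inf_paths :: "('v, 'e) bratteli \<Rightarrow> (nat \<Rightarrow> 'e) set" where
  "inf_paths B = {x \<in> (\<Pi>\<^sub>E i\<in>{1..}. edges_at B i). \<forall>i\<ge>1. rng B (x i) = src B (x (i + 1))}"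

definition cylinder :: "('v, 'e) bratteli \<Rightarrow> nat \<Rightarrow> nat \<Rightarrow> (nat \<Rightarrow> 'e) \<Rightarrow> (nat \<Rightarrow> 'e) set" where
  "cylinder B m n p = {x \<in> inf_paths B. \<forall>i\<in>{m..n}. x i = p i}"

definition path_topology :: "('v, 'e) bratteli \<Rightarrow> (nat \<Rightarrow> 'e) topology" where
  "path_topology B = topology_generated_by {cylinder B m n p | m n p. 1 \<le> m \<and> m \<le> n}"

text \<open>The paths from the root to a vertex \<open>v\<close> at level \<open>n\<close>; for \<open>n = 0\<close> this is the empty path.\<close>

definition fin_paths_to :: "('v, 'e) bratteli \<Rightarrow> nat \<Rightarrow> 'v \<Rightarrow> (nat \<Rightarrow> 'e) set" where
  "fin_paths_to B n v = {p \<in> (\<Pi>\<^sub>E i\<in>{1..n}. edges_at B i).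
     (\<forall>i. 1 \<le> i \<and> i < n \<longrightarrow> rng B (p i) = src B (p (i + 1))) \<and>
     (if n = 0 then v \<in> verts_at B 0 else rng B (p n) = v)}"


definition in_edges :: "('v, 'e) bratteli \<Rightarrow> 'v \<Rightarrow> 'e set" where
  "in_edges B v = {e \<in> all_edges B. rng B e = v}"

definition linear_orders_at :: "('v, 'e) bratteli \<Rightarrow> 'v \<Rightarrow> 'e rel set" where
  "linear_orders_at B v = {R. linear_order_on (in_edges B v) R}"

definition order_set :: "('v, 'e) bratteli \<Rightarrow> ('v \<Rightarrow> 'e rel) set" where
  "order_set B = (\<Pi>\<^sub>E v\<in>all_verts B - verts_at B 0. linear_orders_at B v)"

text \<open>The space of this measure is \<open>order_set B\<close>.\<close>

definition order_measure :: "('v, 'e) bratteli \<Rightarrow> ('v \<Rightarrow> 'e rel) measure" where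
  "order_measure B = completion
     (\<Pi>\<^sub>M v\<in>all_verts B - verts_at B 0. uniform_count_measure (linear_orders_at B v))"


text \<open>The relations in an order are reflexive: \<open>(f, e) \<in> \<omega> v\<close> reads \<open>f \<le> e\<close>.\<close>

definition max_edge :: "('v, 'e) bratteli \<Rightarrow> ('v \<Rightarrow> 'e rel) \<Rightarrow> 'e \<Rightarrow> bool" where
  "max_edge B \<omega> e \<longleftrightarrow> e \<in> all_edges B \<and> (\<forall>f\<in>in_edges B (rng B e). (f, e) \<in> \<omega> (rng B e))"

definition min_edge :: "('v, 'e) bratteli \<Rightarrow> ('v \<Rightarrow> 'e rel) \<Rightarrow> 'e \<Rightarrow> bool" where
  "min_edge B \<omega> e \<longleftrightarrow> e \<in> all_edges B \<and> (\<forall>f\<in>in_edges B (rng B e). (e, f) \<in> \<omega> (rng B e))"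

definition max_paths :: "('v, 'e) bratteli \<Rightarrow> ('v \<Rightarrow> 'e rel) \<Rightarrow> (nat \<Rightarrow> 'e) set" where
  "max_paths B \<omega> = {x \<in> inf_paths B. \<forall>i\<ge>1. max_edge B \<omega> (x i)}"

definition min_paths :: "('v, 'e) bratteli \<Rightarrow> ('v \<Rightarrow> 'e rel) \<Rightarrow> (nat \<Rightarrow> 'e) set" where
  "min_paths B \<omega> = {x \<in> inf_paths B. \<forall>i\<ge>1. min_edge B \<omega> (x i)}"

definition ext_card :: "'a set \<Rightarrow> enat" where
  "ext_card A = (if finite A then enat (card A) else \<infinity>)"


text \<open>The immediate successor of \<open>e\<close> among the edges with the same range; meaningful when \<open>e\<close> is
  not maximal.\<close>

definition succ_edge :: "('v, 'e) bratteli \<Rightarrow> ('v \<Rightarrow> 'e rel) \<Rightarrow> 'e \<Rightarrow> 'e" where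
  "succ_edge B \<omega> e = (THE f. f \<in> in_edges B (rng B e) \<and> f \<noteq> e \<and> (e, f) \<in> \<omega> (rng B e) \<and>
     (\<forall>g\<in>in_edges B (rng B e). g \<noteq> e \<and> (e, g) \<in> \<omega> (rng B e) \<longrightarrow> (f, g) \<in> \<omega> (rng B e)))"

definition min_path_to :: "('v, 'e) bratteli \<Rightarrow> ('v \<Rightarrow> 'e rel) \<Rightarrow> nat \<Rightarrow> 'v \<Rightarrow> nat \<Rightarrow> 'e" where
  "min_path_to B \<omega> n v = (THE p. p \<in> fin_paths_to B n v \<and> (\<forall>i\<in>{1..n}. min_edge B \<omega> (p i)))"

text \<open>Meaningful on \<open>inf_paths B - max_paths B \<omega>\<close>. Index 0 carries no edge and is copied from \<open>x\<close>.\<close>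

definition succ_map :: "('v, 'e) bratteli \<Rightarrow> ('v \<Rightarrow> 'e rel) \<Rightarrow> (nat \<Rightarrow> 'e) \<Rightarrow> nat \<Rightarrow> 'e" where
  "succ_map B \<omega> x =
     (let k = (LEAST n. 1 \<le> n \<and> \<not> max_edge B \<omega> (x n));
          e = succ_edge B \<omega> (x k)
      in (\<lambda>i. if 1 \<le> i \<and> i < k then min_path_to B \<omega> (k - 1) (src B e) i
              else if i = k then e
              else x i))"

definition continuous_vershik_map ::
    "('v, 'e) bratteli \<Rightarrow> ('v \<Rightarrow> 'e rel) \<Rightarrow> ((nat \<Rightarrow> 'e) \<Rightarrow> nat \<Rightarrow> 'e) \<Rightarrow> bool" where
  "continuous_vershik_map B \<omega> \<phi> \<longleftrightarrow>
     homeomorphic_map (path_topology B) (path_topology B) \<phi> \<and>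
     \<phi> ` max_paths B \<omega> = min_paths B \<omega> \<and>
     (\<forall>x\<in>inf_paths B - max_paths B \<omega>. \<phi> x = succ_map B \<omega> x)"

definition perfect_order :: "('v, 'e) bratteli \<Rightarrow> ('v \<Rightarrow> 'e rel) \<Rightarrow> bool" where
  "perfect_order B \<omega> \<longleftrightarrow> (\<exists>\<phi>. continuous_vershik_map B \<omega> \<phi>)"

definition imperfect_order :: "('v, 'e) bratteli \<Rightarrow> ('v \<Rightarrow> 'e rel) \<Rightarrow> bool" where
  "imperfect_order B \<omega> \<longleftrightarrow> \<not> perfect_order B \<omega>"

end

theory Submission
  imports Defs "HOL-Probability.Infinite_Product_Measure"
begin

text \<open>
  A continuous Vershik map leaves a trace on the order at every single vertex that a random order at a
  vertex with many incoming edges can hardly show.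

  Suppose that \<open>\<phi>\<close> is a continuous Vershik map for \<open>\<omega>\<close> and that \<open>\<omega>\<close> has two minimal paths. Choose \<open>N\<close>
  such that these paths have separated at level \<open>N\<close>; then at every later level there are vertices
  whose minimal paths from the root pass through different vertices of level \<open>N\<close>
  (\<open>two_min_paths_separate\<close>). The path space is compact, so there is \<open>K\<close> such that the first \<open>K\<close> edges
  of \<open>x\<close> determine the edge of \<open>\<phi> x\<close> at level \<open>N\<close>. Now let \<open>e\<close> and \<open>f\<close> be consecutive edges into a
  vertex \<open>u\<close> of level \<open>n + 1\<close>, where \<open>n \<ge> K\<close>. The successor of a path that reaches \<open>e\<close> along maximal edges
  reaches \<open>f\<close> along minimal edges. Hence there is a function \<open>F\<close> from the vertices of level \<open>K\<close> to
  those of level \<open>N\<close>, the same for all \<open>n\<close> and \<open>u\<close>, that sends the vertex passed at level \<open>K\<close> by the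
  maximal path to the source of \<open>e\<close> to the vertex passed at level \<open>N\<close> by the minimal path to the
  source of \<open>f\<close> (\<open>vershik_map_factor\<close>).

  Fix \<open>N\<close>, \<open>K\<close>, \<open>F\<close>, a vertex \<open>u\<close> of level \<open>n + 1\<close> and the orders at the levels up to \<open>n\<close>. Every
  edge \<open>e\<close> into \<open>u\<close> then carries two labels: \<open>f(e)\<close>, the value of \<open>F\<close> at the vertex passed by the
  maximal path to its source, and \<open>b(e)\<close>, the vertex passed by the minimal path to its source. The
  order at \<open>u\<close> has to satisfy \<open>f(e) = b(e')\<close> for all consecutive \<open>e\<close>, \<open>e'\<close>, while \<open>b\<close> is not constant. Among
  the orders of \<open>k\<close> edges the proportion of these is at most \<open>3 / k\<close>
  (\<open>card_compatible_linear_orders_le\<close>): there is an edge \<open>a\<close> with \<open>f(a) \<noteq> b(a)\<close>, and once the other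
  edges are ordered, no more than three of the \<open>k\<close> places for \<open>a\<close> are possible.

  Complete connectedness gives \<open>k \<ge> |V\<^sub>n|\<close>. The number of functions \<open>F\<close> is independent of \<open>n\<close>,
  so for fixed \<open>N\<close> and \<open>K\<close> the probability that some \<open>F\<close> works at level \<open>n\<close> is \<open>O(1 / |V\<^sub>n|)\<close>. In
  infinite rank \<open>|V\<^sub>n|\<close> is unbounded, so the event that one \<open>F\<close> works at all levels from \<open>K\<close> on is null
  (\<open>AE_not_always_compatible\<close>), and there are only countably many pairs of \<open>N\<close> and \<open>K\<close>.
\<close>

section \<open>Consecutive elements of finite linear orders\<close>

lemma linear_order_onD:
  assumes "linear_order_on A R"
  shows "x \<in> A \<Longrightarrow> (x, x) \<in> R"
    and "(x, y) \<in> R \<Longrightarrow> (y, z) \<in> R \<Longrightarrow> (x, z) \<in> R"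
    and "(x, y) \<in> R \<Longrightarrow> (y, x) \<in> R \<Longrightarrow> x = y"
    and "x \<in> A \<Longrightarrow> y \<in> A \<Longrightarrow> (x, y) \<in> R \<or> (y, x) \<in> R"
    and "(x, y) \<in> R \<Longrightarrow> x \<in> A \<and> y \<in> A"
proof -
  have R: "refl_on A R" "trans R" "antisym R" "total_on A R" "R \<subseteq> A \<times> A"
    using assms by (auto simp: order_on_defs)
  show "x \<in> A \<Longrightarrow> (x, x) \<in> R" using R(1) by (auto simp: refl_on_def)
  then show "x \<in> A \<Longrightarrow> y \<in> A \<Longrightarrow> (x, y) \<in> R \<or> (y, x) \<in> R"
    using R(4) by (auto simp: total_on_def)
  show "(x, y) \<in> R \<Longrightarrow> (y, z) \<in> R \<Longrightarrow> (x, z) \<in> R" using R(2) by (rule transD)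
  show "(x, y) \<in> R \<Longrightarrow> (y, x) \<in> R \<Longrightarrow> x = y" using R(3) by (auto simp: antisym_def)
  show "(x, y) \<in> R \<Longrightarrow> x \<in> A \<and> y \<in> A" using R(5) by auto
qed

lemma linear_order_onI:
  assumes "\<And>x. x \<in> A \<Longrightarrow> (x, x) \<in> R"
    and "\<And>x y z. (x, y) \<in> R \<Longrightarrow> (y, z) \<in> R \<Longrightarrow> (x, z) \<in> R"
    and "\<And>x y. (x, y) \<in> R \<Longrightarrow> (y, x) \<in> R \<Longrightarrow> x = y"
    and "\<And>x y. x \<in> A \<Longrightarrow> y \<in> A \<Longrightarrow> (x, y) \<in> R \<or> (y, x) \<in> R"
    and "R \<subseteq> A \<times> A"
  shows "linear_order_on A R"
  unfolding order_on_defs refl_on_def trans_def antisym_def total_on_def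
  using assms by blast

lemma finite_linear_order_greatest:
  assumes "linear_order_on A R" "finite S" "S \<noteq> {}" "S \<subseteq> A"
  shows "\<exists>m\<in>S. \<forall>y\<in>S. (y, m) \<in> R"
  using assms(2-4)
proof (induction rule: finite_ne_induct)
  case (singleton x)
  then show ?case using linear_order_onD(1)[OF assms(1)] by auto
next
  case (insert x S)
  then obtain m where m: "m \<in> S" "\<forall>y\<in>S. (y, m) \<in> R" by auto
  note L = linear_order_onD[OF assms(1)]
  have x: "x \<in> A" "m \<in> A" using insert.prems m(1) by auto
  show ?case
  proof (cases "(x, m) \<in> R")
    case True then show ?thesis using m by auto
  next
    case False
    then have "(m, x) \<in> R" using L(4)[of x m] x by auto
    then have "\<forall>y\<in>insert x S. (y, x) \<in> R" using m(2) L(1)[OF x(1)] L(2) by blast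
    then show ?thesis by blast
  qed
qed

lemma finite_linear_orders:
  assumes "finite A"
  shows "finite {R. linear_order_on A R}"
proof (rule finite_subset)
  show "{R. linear_order_on A R} \<subseteq> Pow (A \<times> A)"
    using linear_order_onD(5) by fastforce
qed (use assms in simp)

text \<open>The covering relation, in the form in which \<^const>\<open>succ_edge\<close> selects the successor of an
  edge.\<close>

definition covers :: "'a set \<Rightarrow> 'a rel \<Rightarrow> 'a \<Rightarrow> 'a \<Rightarrow> bool" where
  "covers A R e f \<longleftrightarrow> f \<in> A \<and> f \<noteq> e \<and> (e, f) \<in> R \<and> (\<forall>g\<in>A. g \<noteq> e \<and> (e, g) \<in> R \<longrightarrow> (f, g) \<in> R)"

lemma covers_predecessor_exists:
  assumes R: "linear_order_on A R" and "finite A" "(y, x) \<in> R" "y \<noteq> x"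
  shows "\<exists>p. covers A R p x"
proof -
  note L = linear_order_onD[OF R]
  let ?S = "{y. (y, x) \<in> R \<and> y \<noteq> x}"
  have sub: "?S \<subseteq> A" using L(5) by auto
  obtain p where p: "(p, x) \<in> R" "p \<noteq> x" "\<forall>y\<in>?S. (y, p) \<in> R"
    using finite_linear_order_greatest[OF R finite_subset[OF sub \<open>finite A\<close>] _ sub] assms(3,4)
    by blast
  have "(x, g) \<in> R" if "g \<in> A" "g \<noteq> p" "(p, g) \<in> R" for g
  proof (rule ccontr)
    assume n: "(x, g) \<notin> R"
    then have "(g, x) \<in> R" "g \<noteq> x" using L(4)[of x g] L(5)[OF p(1)] that(1) L(1) by auto
    then have "(g, p) \<in> R" using p(3) by auto
    then show False using L(3) that by blast
  qed
  then have "covers A R p x" using p L(5)[OF p(1)] by (auto simp: covers_def)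
  then show ?thesis by blast
qed

lemma covers_successor_exists:
  assumes R: "linear_order_on A R" and "finite A" "(x, y) \<in> R" "y \<noteq> x"
  shows "\<exists>q. covers A R x q"
proof -
  note L = linear_order_onD[OF R]
  have R': "linear_order_on A (R\<inverse>)" using R by simp
  let ?S = "{y. (x, y) \<in> R \<and> y \<noteq> x}"
  have sub: "?S \<subseteq> A" using L(5) by auto
  obtain q where q: "(x, q) \<in> R" "q \<noteq> x" "\<forall>y\<in>?S. (q, y) \<in> R"
    using finite_linear_order_greatest[OF R' finite_subset[OF sub \<open>finite A\<close>] _ sub] assms(3,4)
    by blast
  then have "covers A R x q" using L(5)[OF q(1)] by (auto simp: covers_def)
  then show ?thesis by blast
qed

text \<open>Any two elements of a finite linear order are joined by a chain of immediate successors, so a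
  function that does not change from an element to its successor is constant.\<close>

lemma constant_along_covers_imp_constant:
  assumes R: "linear_order_on A R" and "finite A"
    and step: "\<And>e f. covers A R e f \<Longrightarrow> b e = b f"
    and "x \<in> A" "y \<in> A"
  shows "b x = b y"
proof -
  note L = linear_order_onD[OF R]
  have down: "b x = b y" if "(x, y) \<in> R" for x y
    using that
  proof (induction "card {z. (x, z) \<in> R \<and> (z, y) \<in> R}" arbitrary: y rule: less_induct)
    case less
    show ?case
    proof (cases "x = y")
      case False
      obtain p where p: "covers A R p y"
        using covers_predecessor_exists[OF R \<open>finite A\<close> less.prems False] by blast
      have py: "(p, y) \<in> R" "p \<noteq> y" using p by (auto simp: covers_def)
      have xp: "(x, p) \<in> R"
      proof (rule ccontr)
        assume "(x, p) \<notin> R"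
        then have "(p, x) \<in> R" "x \<noteq> p" using L(4)[of x p] L(5)[OF less.prems] L(5)[OF py(1)] L(1)
          by auto
        then have "(y, x) \<in> R" using p L(5)[OF less.prems] by (auto simp: covers_def)
        then show False using L(3)[OF less.prems] False by auto
      qed
      have "{z. (x, z) \<in> R \<and> (z, p) \<in> R} \<subset> {z. (x, z) \<in> R \<and> (z, y) \<in> R}"
      proof
        show "{z. (x, z) \<in> R \<and> (z, p) \<in> R} \<subseteq> {z. (x, z) \<in> R \<and> (z, y) \<in> R}"
          using py L(2) by blast
        have "(y, p) \<notin> R" using L(3) py by blast
        moreover have "(y, y) \<in> R" using L(1) L(5)[OF py(1)] by auto
        ultimately show "{z. (x, z) \<in> R \<and> (z, p) \<in> R} \<noteq> {z. (x, z) \<in> R \<and> (z, y) \<in> R}"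
          using less.prems by blast
      qed
      moreover have "finite {z. (x, z) \<in> R \<and> (z, y) \<in> R}"
        by (rule finite_subset[OF _ \<open>finite A\<close>]) (use L(5) in blast)
      ultimately have "b x = b p" using less.hyps[OF psubset_card_mono xp] by blast
      then show ?thesis using step[OF p] by simp
    qed simp
  qed
  show ?thesis using L(4)[OF assms(4,5)] down by metis
qed

section \<open>Orders with prescribed labels on consecutive elements\<close>

definition delete_point :: "'a \<Rightarrow> 'a rel \<Rightarrow> 'a rel" where
  "delete_point a R = {(x, y) \<in> R. x \<noteq> a \<and> y \<noteq> a}"

lemma delete_point_linear_order:
  assumes "linear_order_on A R"
  shows "linear_order_on (A - {a}) (delete_point a R)"
proof -
  note L = linear_order_onD[OF assms]
  show ?thesis
  proof (rule linear_order_onI)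
    fix x y z assume "(x, y) \<in> delete_point a R" "(y, z) \<in> delete_point a R"
    then show "(x, z) \<in> delete_point a R"
      using L(2) unfolding delete_point_def by blast
  next
    fix x y assume "(x, y) \<in> delete_point a R" "(y, x) \<in> delete_point a R"
    then show "x = y" using L(3) unfolding delete_point_def by blast
  next
    fix x y assume "x \<in> A - {a}" "y \<in> A - {a}"
    then show "(x, y) \<in> delete_point a R \<or> (y, x) \<in> delete_point a R"
      using L(4) unfolding delete_point_def by blast
  next
    show "delete_point a R \<subseteq> (A - {a}) \<times> (A - {a})"
      using L(5) unfolding delete_point_def by blast
  qed (use L(1) in \<open>auto simp: delete_point_def\<close>)
qed

lemma linear_order_eq_of_delete_point:
  assumes R1: "linear_order_on A R1" and R2: "linear_order_on A R2"
    and del: "delete_point a R1 = delete_point a R2"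
    and below: "\<And>y. y \<in> A - {a} \<Longrightarrow> (y, a) \<in> R1 \<longleftrightarrow> (y, a) \<in> R2"
  shows "R1 = R2"
proof -
  note L1 = linear_order_onD[OF R1] and L2 = linear_order_onD[OF R2]
  have "(x, y) \<in> R1 \<longleftrightarrow> (x, y) \<in> R2" if "x \<in> A" "y \<in> A" for x y
  proof (cases "x = a \<or> y = a")
    case False
    then show ?thesis using del unfolding delete_point_def by blast
  next
    case True
    have above: "(a, z) \<in> R1 \<longleftrightarrow> (a, z) \<in> R2" if "z \<in> A" "a \<in> A" "z \<noteq> a" for z
      using below[of z] that L1(3,4) L2(3,4) by blast
    show ?thesis using True that above below L1(1) L2(1) by (cases "x = a"; cases "y = a") auto
  qed
  then have "p \<in> R1 \<longleftrightarrow> p \<in> R2" for p using L1(5) L2(5) by (cases p) blast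
  then show ?thesis by blast
qed

text \<open>The order \<open>insert_point A a (R, x)\<close> puts \<open>a\<close> immediately below \<open>x\<close>, and on top of everything when
  \<open>x = a\<close>. Letting \<open>x\<close> range over \<open>A\<close> thus lists the \<open>card A\<close> places at which \<open>a\<close> can be inserted
  into an order of \<open>A - {a}\<close>.\<close>

definition insert_point :: "'a set \<Rightarrow> 'a \<Rightarrow> 'a rel \<times> 'a \<Rightarrow> 'a rel" where
  "insert_point A a = (\<lambda>(R, x).
     let D = {y \<in> A - {a}. x = a \<or> (y, x) \<in> R \<and> y \<noteq> x}
     in R \<union> D \<times> {a} \<union> {a} \<times> (A - D))"

text \<open>Inserting \<open>a\<close> is injective: deleting \<open>a\<close> gives back the order of \<open>A - {a}\<close>, and the elements below
  \<open>a\<close> determine the place.\<close>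

lemma card_linear_orders_ge:
  assumes "finite A" "a \<in> A"
  shows "card A * card {R. linear_order_on (A - {a}) R} \<le> card {R. linear_order_on A R}"
proof -
  let ?L = "{R. linear_order_on (A - {a}) R}"
  define D where "D R x = {y \<in> A - {a}. x = a \<or> (y, x) \<in> R \<and> y \<noteq> x}" for R x
  have ins: "insert_point A a (R, x) = R \<union> D R x \<times> {a} \<union> {a} \<times> (A - D R x)" for R x
    by (simp add: insert_point_def D_def Let_def)
  have Dsub: "D R x \<subseteq> A - {a}" for R x by (auto simp: D_def)
  have lin: "linear_order_on A (insert_point A a (R, x))" if "R \<in> ?L" "x \<in> A" for R x
  proof -
    have R: "linear_order_on (A - {a}) R" using that by simp
    note L = linear_order_onD[OF R]
    have down: "y \<in> D R x" if "(y, z) \<in> R" "z \<in> D R x" for y z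
      using that L(2,3,5) unfolding D_def by blast
    show ?thesis
      unfolding ins
    proof (rule linear_order_onI)
      fix u assume "u \<in> A"
      then show "(u, u) \<in> R \<union> D R x \<times> {a} \<union> {a} \<times> (A - D R x)"
        using L(1) Dsub by (cases "u = a") auto
    next
      fix u v w assume "(u, v) \<in> R \<union> D R x \<times> {a} \<union> {a} \<times> (A - D R x)"
        "(v, w) \<in> R \<union> D R x \<times> {a} \<union> {a} \<times> (A - D R x)"
      moreover have "(u, w) \<in> R" if "u \<in> D R x" "w \<in> A - D R x" "w \<noteq> a"
      proof (rule ccontr)
        assume "(u, w) \<notin> R"
        then have "(w, u) \<in> R" using L(4)[of u w] that Dsub by auto
        then show False using down that by blast
      qed
      moreover have "(u, w) \<in> R" if "(u, v) \<in> R" "(v, w) \<in> R" using L(2) that .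
      ultimately show "(u, w) \<in> R \<union> D R x \<times> {a} \<union> {a} \<times> (A - D R x)"
        using down[of u v] down[of v w] L(5)[of u v] L(5)[of v w] Dsub[of R x] by blast
    next
      fix u v assume "(u, v) \<in> R \<union> D R x \<times> {a} \<union> {a} \<times> (A - D R x)"
        "(v, u) \<in> R \<union> D R x \<times> {a} \<union> {a} \<times> (A - D R x)"
      then show "u = v" using L(3)[of u v] L(5)[of u v] L(5)[of v u] Dsub[of R x] by blast
    next
      fix u v assume "u \<in> A" "v \<in> A"
      then show "(u, v) \<in> R \<union> D R x \<times> {a} \<union> {a} \<times> (A - D R x) \<or>
          (v, u) \<in> R \<union> D R x \<times> {a} \<union> {a} \<times> (A - D R x)"
        using L(4)[of u v] Dsub[of R x] by blast
    next
      show "R \<union> D R x \<times> {a} \<union> {a} \<times> (A - D R x) \<subseteq> A \<times> A"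
        using \<open>a \<in> A\<close> by (auto simp: D_def dest: L(5))
    qed
  qed
  have inj: "inj_on (insert_point A a) (?L \<times> A)"
  proof (rule inj_onI, clarify)
    fix R x S y
    assume R: "linear_order_on (A - {a}) R" and S: "linear_order_on (A - {a}) S"
      and xy: "x \<in> A" "y \<in> A" and eq: "insert_point A a (R, x) = insert_point A a (S, y)"
    note L = linear_order_onD[OF R]
    have "T = delete_point a (insert_point A a (T, z))" if "linear_order_on (A - {a}) T" for T z
      unfolding ins delete_point_def using linear_order_onD(5)[OF that] by blast
    then have RS: "R = S" using eq R S by metis
    have Dz: "D T z = {u. u \<noteq> a \<and> (u, a) \<in> insert_point A a (T, z)}"
      if "linear_order_on (A - {a}) T" for T z
      unfolding ins using linear_order_onD(5)[OF that] Dsub[of T z] by blast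
    from this[OF R, of x] this[OF S, of y] have DD: "D R x = D R y"
      using eq unfolding RS by simp
    have "x = y"
    proof (rule ccontr)
      assume ne: "x \<noteq> y"
      \<comment> \<open>The smaller of two different places lies below the point inserted at the larger one, but
        not below the point inserted at itself.\<close>
      have "x \<in> D R y \<or> y \<in> D R x"
        using ne xy L(4)[of x y] unfolding D_def by blast
      moreover have "x \<notin> D R x" "y \<notin> D R y" unfolding D_def by auto
      ultimately show False using DD by blast
    qed
    then show "R = S \<and> x = y" using RS by simp
  qed
  have "card (?L \<times> A) = card (insert_point A a ` (?L \<times> A))" using card_image[OF inj] by simp
  also have "\<dots> \<le> card {R. linear_order_on A R}"
    by (rule card_mono[OF finite_linear_orders[OF \<open>finite A\<close>]]) (use lin in auto)
  finally show ?thesis by (simp add: card_cartesian_product mult.commute)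
qed

text \<open>Let \<open>a\<close> sit between \<open>p\<close> and \<open>q\<close> in \<open>R1\<close>. Compatibility of \<open>R1\<close> gives \<open>f p = b a\<close> and
  \<open>f a = b q\<close>. If \<open>a\<close> sat elsewhere in \<open>R2\<close>, then \<open>q\<close> would succeed \<open>p\<close> there, and compatibility of
  \<open>R2\<close> would give \<open>f p = b q\<close>, hence \<open>f a = b a\<close>.\<close>

lemma interior_reinsertion_unique:
  fixes f b :: "'a \<Rightarrow> 'c"
  assumes "finite A" and fb: "f a \<noteq> b a"
    and R1: "linear_order_on A R1" and R2: "linear_order_on A R2"
    and c1: "\<And>e g. covers A R1 e g \<Longrightarrow> f e = b g" and c2: "\<And>e g. covers A R2 e g \<Longrightarrow> f e = b g"
    and interior: "\<exists>y. y \<noteq> a \<and> (y, a) \<in> R1" "\<exists>y. y \<noteq> a \<and> (a, y) \<in> R1"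
    and del: "delete_point a R1 = delete_point a R2"
  shows "R1 = R2"
proof (rule linear_order_eq_of_delete_point[OF R1 R2 del])
  note L1 = linear_order_onD[OF R1] and L2 = linear_order_onD[OF R2]
  have same: "(x, y) \<in> R1 \<longleftrightarrow> (x, y) \<in> R2" if "x \<noteq> a" "y \<noteq> a" for x y
    using del that unfolding delete_point_def by blast
  obtain p where p: "covers A R1 p a"
    using covers_predecessor_exists[OF R1 \<open>finite A\<close>] interior(1) by blast
  obtain q where q: "covers A R1 a q"
    using covers_successor_exists[OF R1 \<open>finite A\<close>] interior(2) by blast
  have pa: "(p, a) \<in> R1" "p \<noteq> a" "p \<in> A" "a \<in> A"
    and pg: "\<And>g. g \<noteq> p \<Longrightarrow> (p, g) \<in> R1 \<Longrightarrow> (a, g) \<in> R1"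
    using p L1(5) unfolding covers_def by blast+
  have qa: "(a, q) \<in> R1" "q \<noteq> a" "q \<in> A"
    and qg: "\<And>g. g \<noteq> a \<Longrightarrow> (a, g) \<in> R1 \<Longrightarrow> (q, g) \<in> R1"
    using q L1(5) unfolding covers_def by blast+
  have pq: "(p, q) \<in> R1" using L1(2)[OF pa(1) qa(1)] .
  have pq_ne: "p \<noteq> q" using L1(3)[of p a] pa qa by auto
  have pq2: "(p, q) \<in> R2" using same pq pa qa by blast
  have "f p \<noteq> b q" using c1[OF p] c1[OF q] fb by simp
  then have "\<not> covers A R2 p q" using c2 by blast
  then obtain g where g: "g \<in> A" "g \<noteq> p" "(p, g) \<in> R2" "(q, g) \<notin> R2"
    using pq2 pq_ne qa unfolding covers_def by blast
  have ga: "g = a"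
  proof (rule ccontr)
    assume "g \<noteq> a"
    then show False using g same pa qa pg[of g] qg[of g] by blast
  qed
  have pa2: "(p, a) \<in> R2" and aq2: "(a, q) \<in> R2"
    using g ga L2(4)[of a q] qa pa by auto
  fix y assume y: "y \<in> A - {a}"
  show "(y, a) \<in> R1 \<longleftrightarrow> (y, a) \<in> R2"
  proof (cases "(y, p) \<in> R1")
    case True
    then show ?thesis using L1(2)[OF _ pa(1)] L2(2)[OF _ pa2] same[of y p] y pa by blast
  next
    case False
    then have "(p, y) \<in> R1" "y \<noteq> p" using L1(4)[of y p] L1(1) y pa by auto
    then have ay: "(a, y) \<in> R1" using pg by blast
    then have "(q, y) \<in> R2" using qg same[of q y] y qa by blast
    then have "(a, y) \<in> R2" using L2(2) aq2 by blast
    then show ?thesis using ay y L1(3) L2(3) by blast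
  qed
qed

text \<open>If \<open>f\<close> and \<open>b\<close> agree on \<open>A\<close>, a compatible order would make \<open>b\<close>
  constant. Otherwise some \<open>a\<close> has \<open>f a \<noteq> b a\<close>, and after fixing the order of the other points \<open>a\<close> can
  be inserted at the bottom, at the top, or at no more than one place in between; altogether there
  are \<open>card A\<close> places.\<close>

lemma card_compatible_linear_orders_le:
  fixes f b :: "'a \<Rightarrow> 'c"
  assumes "finite A" and nonconst: "\<exists>x\<in>A. \<exists>y\<in>A. b x \<noteq> b y"
  shows "card A * card {R. linear_order_on A R \<and> (\<forall>e g. covers A R e g \<longrightarrow> f e = b g)}
    \<le> 3 * card {R. linear_order_on A R}"
proof (cases "\<exists>a\<in>A. f a \<noteq> b a")
  case False
  have "{R. linear_order_on A R \<and> (\<forall>e g. covers A R e g \<longrightarrow> f e = b g)} = {}"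
  proof safe
    fix R assume R: "linear_order_on A R" and c: "\<forall>e g. covers A R e g \<longrightarrow> f e = b g"
    have "b e = b g" if "covers A R e g" for e g
      using False c that linear_order_onD(5)[OF R] unfolding covers_def by metis
    then show "R \<in> {}"
      using constant_along_covers_imp_constant[OF R \<open>finite A\<close>, of b] nonconst by blast
  qed
  then show ?thesis by (simp only: card.empty mult_0_right le0)
next
  case True
  then obtain a where a: "a \<in> A" "f a \<noteq> b a" by blast
  let ?L = "{R. linear_order_on A R}"
  let ?L' = "{R. linear_order_on (A - {a}) R}"
  define C where "C = {R. linear_order_on A R \<and> (\<forall>e g. covers A R e g \<longrightarrow> f e = b g)}"
  define C1 where "C1 = {R \<in> ?L. \<forall>y\<in>A - {a}. (y, a) \<notin> R}"
  define C2 where "C2 = {R \<in> ?L. \<forall>y\<in>A - {a}. (y, a) \<in> R}"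
  define C3 where "C3 = {R \<in> C. (\<exists>y. y \<noteq> a \<and> (y, a) \<in> R) \<and> (\<exists>y. y \<noteq> a \<and> (a, y) \<in> R)}"
  have fin: "finite ?L'" using finite_linear_orders \<open>finite A\<close> by blast
  have bound: "card S \<le> card ?L'" if "inj_on (delete_point a) S" "S \<subseteq> ?L" for S
  proof (rule card_inj_on_le[OF that(1) _ fin])
    show "delete_point a ` S \<subseteq> ?L'" using that(2) by (auto intro: delete_point_linear_order)
  qed
  have i1: "inj_on (delete_point a) C1"
    by (rule inj_onI, rule linear_order_eq_of_delete_point[where A = A and a = a]) (auto simp: C1_def)
  have i2: "inj_on (delete_point a) C2"
    by (rule inj_onI, rule linear_order_eq_of_delete_point[where A = A and a = a]) (auto simp: C2_def)
  have i3: "inj_on (delete_point a) C3"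
  proof (rule inj_onI)
    fix R S assume R: "R \<in> C3" and S: "S \<in> C3" and eq: "delete_point a R = delete_point a S"
    have RL: "linear_order_on A R" and Rc: "\<And>e g. covers A R e g \<Longrightarrow> f e = b g"
      and below: "\<exists>y. y \<noteq> a \<and> (y, a) \<in> R" and above: "\<exists>y. y \<noteq> a \<and> (a, y) \<in> R"
      using R by (simp_all add: C3_def C_def)
    have SL: "linear_order_on A S" and Sc: "\<And>e g. covers A S e g \<Longrightarrow> f e = b g"
      using S by (simp_all add: C3_def C_def)
    show "R = S"
      by (rule interior_reinsertion_unique[where f = f and b = b,
            OF \<open>finite A\<close> a(2) RL SL Rc Sc below above eq])
  qed
  have subL: "C1 \<subseteq> ?L" "C2 \<subseteq> ?L" "C3 \<subseteq> ?L" by (auto simp: C1_def C2_def C3_def C_def)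
  have finL: "finite ?L" using finite_linear_orders \<open>finite A\<close> by blast
  have "C \<subseteq> C1 \<union> C2 \<union> C3"
  proof
    fix R assume R: "R \<in> C"
    then have lin: "linear_order_on A R" by (simp add: C_def)
    note L = linear_order_onD[OF lin]
    show "R \<in> C1 \<union> C2 \<union> C3"
    proof (cases "\<exists>y. y \<noteq> a \<and> (y, a) \<in> R")
      case False
      then show ?thesis using lin by (auto simp: C1_def)
    next
      case below: True
      show ?thesis
      proof (cases "\<exists>y. y \<noteq> a \<and> (a, y) \<in> R")
        case True
        then show ?thesis using R below by (simp add: C3_def)
      next
        case False
        then have "\<forall>y\<in>A - {a}. (y, a) \<in> R" using L(4)[OF _ a(1)] by blast
        then show ?thesis using lin by (simp add: C2_def)
      qed
    qed
  qed
  then have "card C \<le> card (C1 \<union> C2 \<union> C3)"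
    using subL finL by (intro card_mono) (auto intro: finite_subset)
  also have "\<dots> \<le> card C1 + card C2 + card C3"
    using card_Un_le[of "C1 \<union> C2" C3] card_Un_le[of C1 C2] by linarith
  also have "\<dots> \<le> 3 * card ?L'"
    using bound[OF i1 subL(1)] bound[OF i2 subL(2)] bound[OF i3 subL(3)] by linarith
  finally have "card A * card C \<le> card A * (3 * card ?L')" by (rule mult_le_mono2)
  also have "\<dots> \<le> 3 * card ?L" using card_linear_orders_ge[OF \<open>finite A\<close> a(1)] by simp
  finally show ?thesis by (simp add: C_def)
qed

section \<open>Events deciding one coordinate from finitely many others\<close>

text \<open>Because the factors are finite, conditioning on the coordinates in \<open>J\<close> is a finite sum over their
  values \<open>\<tau>\<close>. For each value the coordinate \<open>u\<close> is independent of them and hits the then fixed set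
  \<open>H \<tau>\<close> with probability at most \<open>c\<close>. The last hypothesis says that the set \<open>H \<omega>\<close> depends on the
  coordinates in \<open>J\<close> only.\<close>

lemma (in product_prob_space) emeasure_conditionally_small:
  fixes S :: "'i \<Rightarrow> 'a set" and H :: "('i \<Rightarrow> 'a) \<Rightarrow> 'a set" and c :: ennreal
  assumes M: "\<And>i. M i = uniform_count_measure (S i)" and fin: "\<And>i. finite (S i)"
    and J: "finite J" "J \<subseteq> I" and u: "u \<in> I" "u \<notin> J"
    and H: "\<And>\<tau>. H \<tau> \<subseteq> S u" "\<And>\<tau>. emeasure (M u) (H \<tau>) \<le> c"
    and local: "\<And>\<omega>. \<omega> \<in> space (PiM I M) \<Longrightarrow> H (restrict \<omega> J) = H \<omega>"
  shows "{\<omega> \<in> space (PiM I M). \<omega> u \<in> H \<omega>} \<in> sets (PiM I M)"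
    and "emeasure (PiM I M) {\<omega> \<in> space (PiM I M). \<omega> u \<in> H \<omega>} \<le> c"
proof -
  let ?P = "PiM I M"
  let ?T = "PiE J S"
  define X where "X \<tau> i = (if i = u then H \<tau> else {\<tau> i})" for \<tau> :: "'i \<Rightarrow> 'a" and i
  let ?cyl = "\<lambda>\<tau>. {\<omega> \<in> space ?P. \<forall>i\<in>insert u J. \<omega> i \<in> X \<tau> i}"
  have spM: "space (M i) = S i" and setsM: "sets (M i) = Pow (S i)" for i
    by (simp_all add: M space_uniform_count_measure sets_uniform_count_measure)
  have finT: "finite ?T" using J(1) fin by (intro finite_PiE) auto
  have XM: "X \<tau> i \<in> sets (M i)" if "\<tau> \<in> ?T" "i \<in> insert u J" for \<tau> i
    using that H(1) by (auto simp: X_def setsM)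
  have cyl_sets: "?cyl \<tau> \<in> sets ?P" if "\<tau> \<in> ?T" for \<tau>
    using J u XM[OF that] by (intro sets.sets_Collect_finite_All sets_Collect_single) auto
  have eq: "{\<omega> \<in> space ?P. \<omega> u \<in> H \<omega>} = (\<Union>\<tau>\<in>?T. ?cyl \<tau>)"
  proof safe
    fix \<omega> assume w: "\<omega> \<in> space ?P" "\<omega> u \<in> H \<omega>"
    have "restrict \<omega> J \<in> ?T" using w J by (auto simp: space_PiM spM)
    moreover have "\<omega> \<in> ?cyl (restrict \<omega> J)" using w u local[OF w(1)] by (auto simp: X_def)
    ultimately show "\<omega> \<in> (\<Union>\<tau>\<in>?T. ?cyl \<tau>)" by blast
  next
    fix \<omega> \<tau> assume t: "\<tau> \<in> ?T" and w: "\<omega> \<in> space ?P" "\<forall>i\<in>insert u J. \<omega> i \<in> X \<tau> i"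
    have "\<omega> i = \<tau> i" if "i \<in> J" for i
      using w(2)[rule_format, of i] that u(2) by (cases "i = u") (auto simp: X_def)
    then have "restrict \<omega> J = \<tau>"
      using PiE_arb[OF t] by (auto simp: fun_eq_iff)
    moreover have "\<omega> u \<in> H \<tau>" using w(2) by (simp add: X_def)
    ultimately show "\<omega> u \<in> H \<omega>" using local[OF w(1)] by simp
  qed
  show "{\<omega> \<in> space ?P. \<omega> u \<in> H \<omega>} \<in> sets ?P"
    unfolding eq using finT cyl_sets by (intro sets.finite_UN) auto
  have "emeasure ?P (?cyl \<tau>) \<le> c * (\<Prod>i\<in>J. emeasure (M i) {\<tau> i})" if "\<tau> \<in> ?T" for \<tau>
  proof -
    have "emeasure ?P (?cyl \<tau>) = (\<Prod>i\<in>insert u J. emeasure (M i) (X \<tau> i))"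
      using J u XM[OF that] by (intro emeasure_PiM_Collect) auto
    also have "\<dots> = emeasure (M u) (H \<tau>) * (\<Prod>i\<in>J. emeasure (M i) {\<tau> i})"
    proof -
      have "(\<Prod>i\<in>J. emeasure (M i) (X \<tau> i)) = (\<Prod>i\<in>J. emeasure (M i) {\<tau> i})"
        using u(2) by (intro prod.cong) (auto simp: X_def)
      then show ?thesis using J(1) u(2) by (simp add: X_def)
    qed
    also have "\<dots> \<le> c * (\<Prod>i\<in>J. emeasure (M i) {\<tau> i})" by (intro mult_right_mono H) auto
    finally show ?thesis .
  qed
  then have "emeasure ?P (\<Union>\<tau>\<in>?T. ?cyl \<tau>) \<le> (\<Sum>\<tau>\<in>?T. c * (\<Prod>i\<in>J. emeasure (M i) {\<tau> i}))"
    using finT cyl_sets by (intro order.trans[OF emeasure_subadditive_finite] sum_mono) auto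
  also have "\<dots> = c * (\<Prod>i\<in>J. \<Sum>s\<in>S i. emeasure (M i) {s})"
    using J(1) fin by (simp add: sum_distrib_left prod_sum_PiE)
  also have "(\<Prod>i\<in>J. \<Sum>s\<in>S i. emeasure (M i) {s}) = 1"
  proof (rule prod.neutral, intro ballI)
    fix i
    have "(\<Sum>s\<in>S i. emeasure (M i) {s}) = emeasure (M i) (S i)"
      by (rule emeasure_eq_sum_singleton[symmetric]) (use fin in \<open>auto simp: setsM\<close>)
    then show "(\<Sum>s\<in>S i. emeasure (M i) {s}) = 1"
      using prob_space.emeasure_space_1[OF prob_space, of i] by (simp add: spM)
  qed
  finally show "emeasure ?P {\<omega> \<in> space ?P. \<omega> u \<in> H \<omega>} \<le> c" unfolding eq by simp
qed

section \<open>Extremal ancestors of vertices\<close>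

text \<open>Once an incoming edge \<open>g v\<close> is chosen at every vertex \<open>v\<close>, each vertex has a unique chain of
  ancestors. The choices used below are the maximal and the minimal edges of an order; ancestors then
  record where the maximal or minimal path into a vertex passes. The number \<open>d\<close> counts levels
  downwards, so that ancestors compose by addition.\<close>

definition back_vertex :: "('v, 'e) bratteli \<Rightarrow> ('v \<Rightarrow> 'e) \<Rightarrow> nat \<Rightarrow> 'v \<Rightarrow> 'v" where
  "back_vertex B g d v = ((\<lambda>u. src B (g u)) ^^ d) v"

lemma back_vertex_0 [simp]: "back_vertex B g 0 v = v"
  by (simp add: back_vertex_def)

lemma back_vertex_Suc: "back_vertex B g (Suc d) v = src B (g (back_vertex B g d v))"
  by (simp add: back_vertex_def)

lemma back_vertex_add: "back_vertex B g c (back_vertex B g d v) = back_vertex B g (c + d) v"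
  by (simp add: back_vertex_def funpow_add)

lemma back_vertex_of_path:
  assumes "m \<le> n"
    and "\<And>i. m \<le> i \<Longrightarrow> i < n \<Longrightarrow> rng B (p i) = src B (p (i + 1))"
    and "\<And>i. m < i \<Longrightarrow> i \<le> n \<Longrightarrow> p i = g (rng B (p i))"
  shows "rng B (p m) = back_vertex B g (n - m) (rng B (p n))"
  using assms
proof (induction m rule: inc_induct)
  case (step m)
  have "rng B (p m) = src B (g (rng B (p (Suc m))))"
    using step.hyps step.prems(1)[of m] step.prems(2)[of "Suc m"] by simp
  also have "\<dots> = back_vertex B g (Suc (n - Suc m)) (rng B (p n))"
    using step.IH step.prems by (simp add: back_vertex_Suc)
  finally show ?case using step.hyps by (simp add: Suc_diff_Suc)
qed simp

definition top_edge :: "('v, 'e) bratteli \<Rightarrow> ('v \<Rightarrow> 'e rel) \<Rightarrow> 'v \<Rightarrow> 'e" where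
  "top_edge B \<omega> v = (THE e. e \<in> in_edges B v \<and> (\<forall>f\<in>in_edges B v. (f, e) \<in> \<omega> v))"

text \<open>Minimal edges are the maximal edges of the reversed order, so facts are proved for maximal edges
  only.\<close>

definition reverse_order :: "('v \<Rightarrow> 'e rel) \<Rightarrow> 'v \<Rightarrow> 'e rel" where
  "reverse_order \<omega> v = (\<omega> v)\<inverse>"

abbreviation max_ancestor :: "('v, 'e) bratteli \<Rightarrow> ('v \<Rightarrow> 'e rel) \<Rightarrow> nat \<Rightarrow> 'v \<Rightarrow> 'v" where
  "max_ancestor B \<omega> \<equiv> back_vertex B (top_edge B \<omega>)"

abbreviation min_ancestor :: "('v, 'e) bratteli \<Rightarrow> ('v \<Rightarrow> 'e rel) \<Rightarrow> nat \<Rightarrow> 'v \<Rightarrow> 'v" where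
  "min_ancestor B \<omega> \<equiv> back_vertex B (top_edge B (reverse_order \<omega>))"

lemma min_edge_iff_max_edge_reverse: "min_edge B \<omega> e \<longleftrightarrow> max_edge B (reverse_order \<omega>) e"
  by (simp add: min_edge_def max_edge_def reverse_order_def)

locale diagram =
  fixes B :: "('v, 'e) bratteli"
  assumes diagram: "bratteli_diagram B"
begin

lemma finite_verts: "finite (verts_at B n)"
  using diagram by (simp add: bratteli_diagram_def)

lemma finite_edges: "finite (edges_at B (Suc n))"
  using diagram by (simp add: bratteli_diagram_def)

lemma src_rng_image:
  "src B ` edges_at B (Suc n) = verts_at B n" "rng B ` edges_at B (Suc n) = verts_at B (Suc n)"
proof -
  have "\<forall>i\<ge>1. rng B ` edges_at B i = verts_at B i \<and> src B ` edges_at B i = verts_at B (i - 1)"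
    using diagram by (simp add: bratteli_diagram_def)
  from this[rule_format, of "Suc n"]
  show "src B ` edges_at B (Suc n) = verts_at B n" "rng B ` edges_at B (Suc n) = verts_at B (Suc n)"
    by auto
qed

lemma src_in: "e \<in> edges_at B (Suc n) \<Longrightarrow> src B e \<in> verts_at B n"
  using src_rng_image(1) by blast

lemma rng_in: "e \<in> edges_at B (Suc n) \<Longrightarrow> rng B e \<in> verts_at B (Suc n)"
  using src_rng_image(2) by blast

lemma level_unique: "v \<in> verts_at B m \<Longrightarrow> v \<in> verts_at B n \<Longrightarrow> m = n"
  using diagram unfolding bratteli_diagram_def disjoint_family_on_def by blast

lemma all_edgesE:
  assumes "e \<in> all_edges B"
  obtains n where "e \<in> edges_at B (Suc n)"
  using assms unfolding all_edges_def by (metis UN_E atLeast_iff One_nat_def Suc_le_D)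

lemma edges_subset_all_edges: "edges_at B (Suc n) \<subseteq> all_edges B"
  unfolding all_edges_def by auto

lemma in_edges_eq:
  assumes "v \<in> verts_at B (Suc n)"
  shows "in_edges B v = {e \<in> edges_at B (Suc n). rng B e = v}"
proof -
  have "e \<in> edges_at B (Suc n)" if "e \<in> all_edges B" "rng B e = v" for e
    using that(1) rng_in[of e] level_unique assms that(2) by (metis all_edgesE)
  then show ?thesis using edges_subset_all_edges by (auto simp: in_edges_def)
qed

lemma finite_in_edges: "finite (in_edges B v)"
proof (cases "\<exists>n. v \<in> verts_at B (Suc n)")
  case True
  then show ?thesis using in_edges_eq finite_edges by fastforce
next
  case False
  then have "in_edges B v = {}"
    using rng_in by (auto simp: in_edges_def elim!: all_edgesE)
  then show ?thesis by simp
qed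

lemma in_edges_nonempty:
  assumes "v \<in> verts_at B (Suc n)"
  shows "in_edges B v \<noteq> {}"
proof -
  obtain e where "e \<in> edges_at B (Suc n)" "rng B e = v"
    using assms src_rng_image(2)[of n] by (metis imageE)
  then show ?thesis using in_edges_eq[OF assms] by blast
qed

lemma nonroot_iff: "v \<in> all_verts B - verts_at B 0 \<longleftrightarrow> (\<exists>n. v \<in> verts_at B (Suc n))"
proof
  assume "v \<in> all_verts B - verts_at B 0"
  then obtain i where "v \<in> verts_at B i" "v \<notin> verts_at B 0" by (auto simp: all_verts_def)
  then show "\<exists>n. v \<in> verts_at B (Suc n)" by (cases i) auto
next
  assume "\<exists>n. v \<in> verts_at B (Suc n)"
  then show "v \<in> all_verts B - verts_at B 0" using level_unique by (fastforce simp: all_verts_def)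
qed

definition edge_choice :: "('v \<Rightarrow> 'e) \<Rightarrow> bool" where
  "edge_choice g \<longleftrightarrow> (\<forall>n. \<forall>v\<in>verts_at B (Suc n). g v \<in> edges_at B (Suc n) \<and> rng B (g v) = v)"

lemma back_vertex_in:
  assumes "edge_choice g" "v \<in> verts_at B n" "d \<le> n"
  shows "back_vertex B g d v \<in> verts_at B (n - d)"
  using assms(3)
proof (induction d)
  case (Suc d)
  then have "back_vertex B g d v \<in> verts_at B (Suc (n - Suc d))" by (simp add: Suc_diff_Suc)
  then show ?case using assms(1) src_in by (auto simp: edge_choice_def back_vertex_Suc)
qed (use assms in simp)

lemma back_edge:
  assumes "edge_choice g" "v \<in> verts_at B n" "1 \<le> i" "i \<le> n"
  shows "g (back_vertex B g (n - i) v) \<in> edges_at B i"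
    and "rng B (g (back_vertex B g (n - i) v)) = back_vertex B g (n - i) v"
proof -
  have "back_vertex B g (n - i) v \<in> verts_at B (Suc (i - 1))"
    using back_vertex_in[OF assms(1,2), of "n - i"] assms(3,4) by simp
  then show "g (back_vertex B g (n - i) v) \<in> edges_at B i"
    and "rng B (g (back_vertex B g (n - i) v)) = back_vertex B g (n - i) v"
    using assms(1,3) unfolding edge_choice_def by fastforce+
qed

lemma back_edge_src:
  assumes "i < n"
  shows "src B (g (back_vertex B g (n - Suc i) v)) = back_vertex B g (n - i) v"
  using assms by (simp flip: back_vertex_Suc add: Suc_diff_Suc)

text \<open>Every vertex is the source of some edge of the next level, so a finite path never gets stuck.\<close>

lemma extend_to_inf_path:
  assumes "1 \<le> n" and edges: "\<And>i. 1 \<le> i \<Longrightarrow> i \<le> n \<Longrightarrow> p i \<in> edges_at B i"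
    and chain: "\<And>i. 1 \<le> i \<Longrightarrow> i < n \<Longrightarrow> rng B (p i) = src B (p (i + 1))"
  obtains x where "x \<in> inf_paths B" "\<And>i. 1 \<le> i \<Longrightarrow> i \<le> n \<Longrightarrow> x i = p i"
proof -
  define h where "h k v = (SOME e. e \<in> edges_at B (Suc k) \<and> src B e = v)" for k v
  have h: "h k v \<in> edges_at B (Suc k) \<and> src B (h k v) = v" if "v \<in> verts_at B k" for k v
  proof -
    obtain e where "e \<in> edges_at B (Suc k)" "src B e = v"
      using \<open>v \<in> verts_at B k\<close> src_rng_image(1)[of k] by (metis imageE)
    then show ?thesis
      using someI[of "\<lambda>e. e \<in> edges_at B (Suc k) \<and> src B e = v" e] by (simp add: h_def)
  qed
  define y where "y = rec_nat (p n) (\<lambda>m e. h (n + m) (rng B e))"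
  have y0: "y 0 = p n" and ys: "y (Suc m) = h (n + m) (rng B (y m))" for m
    by (simp_all add: y_def)
  have yE: "y m \<in> edges_at B (n + m)" for m
  proof (induction m)
    case 0
    then show ?case using edges \<open>1 \<le> n\<close> by (simp add: y0)
  next
    case (Suc m)
    obtain k where k: "n + m = Suc k" using \<open>1 \<le> n\<close> by (cases "n + m") auto
    have "rng B (y m) \<in> verts_at B (n + m)" using Suc rng_in[of "y m" k] by (simp add: k)
    then show ?case using h by (simp add: ys)
  qed
  have ych: "rng B (y m) = src B (y (Suc m))" for m
  proof -
    obtain k where k: "n + m = Suc k" using \<open>1 \<le> n\<close> by (cases "n + m") auto
    have "rng B (y m) \<in> verts_at B (n + m)" using yE[of m] rng_in[of "y m" k] by (simp add: k)
    then show ?thesis using h by (simp add: ys)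
  qed
  define x where "x i = (if i = 0 then undefined else if i \<le> n then p i else y (i - n))" for i
  have "x \<in> inf_paths B"
    unfolding inf_paths_def
  proof (intro CollectI conjI PiE_I allI impI)
    fix i :: nat assume "i \<in> {1..}"
    then show "x i \<in> edges_at B i" using edges[of i] yE[of "i - n"] by (auto simp: x_def)
  next
    fix i :: nat assume "1 \<le> i"
    consider "i < n" | "i = n" | "n < i" by linarith
    then show "rng B (x i) = src B (x (i + 1))"
    proof cases
      case 1 then show ?thesis using chain \<open>1 \<le> i\<close> by (simp add: x_def)
    next
      case 2 then show ?thesis using ych[of 0] \<open>1 \<le> i\<close> by (simp add: x_def y0)
    next
      case 3 then show ?thesis using ych[of "i - n"] \<open>1 \<le> i\<close> by (simp add: x_def Suc_diff_le)
    qed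
  qed (simp add: x_def)
  then show ?thesis using that by (simp add: x_def)
qed

definition vertex_orders :: "('v \<Rightarrow> 'e rel) \<Rightarrow> bool" where
  "vertex_orders \<omega> \<longleftrightarrow> (\<forall>n. \<forall>v\<in>verts_at B (Suc n). linear_order_on (in_edges B v) (\<omega> v))"

lemma vertex_orders_of_order_set: "\<omega> \<in> order_set B \<Longrightarrow> vertex_orders \<omega>"
  unfolding vertex_orders_def order_set_def using nonroot_iff
  by (auto simp: linear_orders_at_def dest!: PiE_mem)

lemma vertex_orders_reverse: "vertex_orders \<omega> \<Longrightarrow> vertex_orders (reverse_order \<omega>)"
  by (simp add: vertex_orders_def reverse_order_def)

lemma top_edge_equality:
  assumes "vertex_orders \<omega>" "v \<in> verts_at B (Suc n)"
    and "e \<in> in_edges B v" "\<And>f. f \<in> in_edges B v \<Longrightarrow> (f, e) \<in> \<omega> v"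
  shows "top_edge B \<omega> v = e"
proof -
  have "linear_order_on (in_edges B v) (\<omega> v)" using assms(1,2) by (auto simp: vertex_orders_def)
  from linear_order_onD(3)[OF this] show ?thesis
    unfolding top_edge_def using assms(3,4) by (intro the_equality) blast+
qed

lemma top_edge_greatest:
  assumes "vertex_orders \<omega>" "v \<in> verts_at B (Suc n)"
  shows "top_edge B \<omega> v \<in> in_edges B v"
    and "f \<in> in_edges B v \<Longrightarrow> (f, top_edge B \<omega> v) \<in> \<omega> v"
proof -
  have lin: "linear_order_on (in_edges B v) (\<omega> v)" using assms by (auto simp: vertex_orders_def)
  obtain e where e: "e \<in> in_edges B v" "\<forall>f\<in>in_edges B v. (f, e) \<in> \<omega> v"
    using finite_linear_order_greatest[OF lin finite_in_edges in_edges_nonempty[OF assms(2)]] by auto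
  moreover have "top_edge B \<omega> v = e" using top_edge_equality[OF assms] e by blast
  ultimately show "top_edge B \<omega> v \<in> in_edges B v"
    and "f \<in> in_edges B v \<Longrightarrow> (f, top_edge B \<omega> v) \<in> \<omega> v" by auto
qed

lemma edge_choice_top_edge: "vertex_orders \<omega> \<Longrightarrow> edge_choice (top_edge B \<omega>)"
  unfolding edge_choice_def using top_edge_greatest(1) in_edges_eq by blast

lemma max_edge_iff:
  assumes "vertex_orders \<omega>" "e \<in> edges_at B i" "1 \<le> i"
  shows "max_edge B \<omega> e \<longleftrightarrow> e = top_edge B \<omega> (rng B e)"
proof -
  obtain n where e: "e \<in> edges_at B (Suc n)" using assms(2,3) by (cases i) auto
  show ?thesis
  proof
    assume "max_edge B \<omega> e"
    then have "top_edge B \<omega> (rng B e) = e"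
      by (intro top_edge_equality[OF assms(1) rng_in[OF e]]) (auto simp: max_edge_def in_edges_def)
    then show "e = top_edge B \<omega> (rng B e)" ..
  next
    assume top: "e = top_edge B \<omega> (rng B e)"
    have "(f, e) \<in> \<omega> (rng B e)" if "f \<in> in_edges B (rng B e)" for f
      using top_edge_greatest(2)[OF assms(1) rng_in[OF e] that] top by simp
    then show "max_edge B \<omega> e"
      using edges_subset_all_edges e by (auto simp: max_edge_def)
  qed
qed

lemma min_edge_iff:
  assumes "vertex_orders \<omega>" "e \<in> edges_at B i" "1 \<le> i"
  shows "min_edge B \<omega> e \<longleftrightarrow> e = top_edge B (reverse_order \<omega>) (rng B e)"
  unfolding min_edge_iff_max_edge_reverse
  by (rule max_edge_iff[OF vertex_orders_reverse[OF assms(1)] assms(2,3)])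

text \<open>Following minimal edges backwards from \<open>v\<close> gives a minimal path to \<open>v\<close>, and it is the only one
  because every edge of a minimal path is determined by its range. Hence the description by
  \<^const>\<open>The\<close> in \<^const>\<open>min_path_to\<close> denotes this path.\<close>

lemma min_path_to_rng:
  assumes \<omega>: "vertex_orders \<omega>" and v: "v \<in> verts_at B n" and "1 \<le> i" "i \<le> n"
  shows "rng B (min_path_to B \<omega> n v i) = min_ancestor B \<omega> (n - i) v"
proof -
  let ?g = "top_edge B (reverse_order \<omega>)"
  have g: "edge_choice ?g" using edge_choice_top_edge vertex_orders_reverse \<omega> by blast
  define q where "q i = (if i \<in> {1..n} then ?g (back_vertex B ?g (n - i) v) else undefined)" for i
  have qi: "q i \<in> edges_at B i" "rng B (q i) = back_vertex B ?g (n - i) v" if "1 \<le> i" "i \<le> n" for i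
    using back_edge[OF g v that] that by (auto simp: q_def)
  have chain: "rng B (q i) = src B (q (i + 1))" if "1 \<le> i" "i < n" for i
    using qi(2)[of i] that by (simp add: q_def back_edge_src)
  have "min_path_to B \<omega> n v = q"
    unfolding min_path_to_def
  proof (rule the_equality)
    have "q i \<in> edges_at B i" if "i \<in> {1..n}" for i using qi(1) that by simp
    moreover have "q i = undefined" if "i \<notin> {1..n}" for i using that by (simp only: q_def if_False)
    ultimately have "q \<in> (\<Pi>\<^sub>E i\<in>{1..n}. edges_at B i)" by (rule PiE_I)
    moreover have "if n = 0 then v \<in> verts_at B 0 else rng B (q n) = v" using qi(2)[of n] v by (cases "n = 0") auto
    ultimately have "q \<in> fin_paths_to B n v" unfolding fin_paths_to_def using chain by blast
    moreover have "min_edge B \<omega> (q i)" if "i \<in> {1..n}" for i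
    proof -
      have "q i = ?g (rng B (q i))" using qi(2)[of i] that by (simp add: q_def)
      then show ?thesis using min_edge_iff[OF \<omega> qi(1)[of i]] that by simp
    qed
    ultimately show "q \<in> fin_paths_to B n v \<and> (\<forall>i\<in>{1..n}. min_edge B \<omega> (q i))" by blast
  next
    fix p assume p: "p \<in> fin_paths_to B n v \<and> (\<forall>i\<in>{1..n}. min_edge B \<omega> (p i))"
    have pE: "p \<in> (\<Pi>\<^sub>E i\<in>{1..n}. edges_at B i)"
      and pc: "\<And>i. 1 \<le> i \<Longrightarrow> i < n \<Longrightarrow> rng B (p i) = src B (p (i + 1))"
      and pn: "n \<noteq> 0 \<Longrightarrow> rng B (p n) = v"
      using p by (auto simp: fin_paths_to_def)
    have pg: "p i = ?g (rng B (p i))" if "1 \<le> i" "i \<le> n" for i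
      using min_edge_iff[OF \<omega> PiE_mem[OF pE, of i]] p that by simp
    show "p = q"
    proof
      fix i
      show "p i = q i"
      proof (cases "i \<in> {1..n}")
        case True
        then have "rng B (p i) = back_vertex B ?g (n - i) (rng B (p n))"
          by (intro back_vertex_of_path pc pg) auto
        then show ?thesis using True pg[of i] pn by (auto simp: q_def)
      next
        case False
        then show ?thesis using PiE_arb[OF pE False] by (simp only: q_def if_False)
      qed
    qed
  qed
  then show ?thesis using qi(2) assms(3,4) by simp
qed

text \<open>Two different minimal paths differ at some level \<open>N\<close>. A minimal edge is determined by its range,
  so they pass through different vertices at level \<open>N\<close>; both therefore keep passing through
  different vertices afterwards, and these vertices have different minimal ancestors at level \<open>N\<close>.\<close>

lemma two_min_paths_separate:
  assumes \<omega>: "vertex_orders \<omega>" and "x \<in> min_paths B \<omega>" "y \<in> min_paths B \<omega>" "x \<noteq> y"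
  obtains N where "1 \<le> N"
    "\<And>n. N \<le> n \<Longrightarrow> \<exists>w\<in>verts_at B n. \<exists>w'\<in>verts_at B n.
       min_ancestor B \<omega> (n - N) w \<noteq> min_ancestor B \<omega> (n - N) w'"
proof -
  let ?g = "top_edge B (reverse_order \<omega>)"
  have edge: "z i \<in> edges_at B i" if "z \<in> inf_paths B" "1 \<le> i" for z i
    using that by (auto simp: inf_paths_def)
  have follow: "z i = ?g (rng B (z i))" if "z \<in> min_paths B \<omega>" "1 \<le> i" for z i
    using min_edge_iff[OF \<omega> edge[of z i]] that by (simp add: min_paths_def)
  have "\<exists>N\<ge>1. x N \<noteq> y N"
  proof (rule ccontr)
    assume "\<not> ?thesis"
    then have "x = y"
      using assms(2,3) by (intro PiE_ext[of _ "{1..}" "edges_at B"]) (auto simp: min_paths_def inf_paths_def)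
    then show False using assms(4) by simp
  qed
  then obtain N where N: "1 \<le> N" "x N \<noteq> y N" by blast
  then have ne: "rng B (x N) \<noteq> rng B (y N)" using follow assms(2,3) by metis
  have anc: "rng B (z N) = min_ancestor B \<omega> (n - N) (rng B (z n)) \<and> rng B (z n) \<in> verts_at B n"
    if z: "z \<in> min_paths B \<omega>" and "N \<le> n" for z n
  proof
    show "rng B (z N) = min_ancestor B \<omega> (n - N) (rng B (z n))"
      using z \<open>N \<le> n\<close> N(1)
      by (intro back_vertex_of_path follow) (auto simp: min_paths_def inf_paths_def)
    show "rng B (z n) \<in> verts_at B n"
      using edge[of z n] rng_in[of "z n" "n - 1"] z \<open>N \<le> n\<close> N(1) by (simp add: min_paths_def)
  qed
  show ?thesis
  proof (rule that[OF N(1)])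
    fix n assume "N \<le> n"
    then show "\<exists>w\<in>verts_at B n. \<exists>w'\<in>verts_at B n.
        min_ancestor B \<omega> (n - N) w \<noteq> min_ancestor B \<omega> (n - N) w'"
      using anc[OF assms(2)] anc[OF assms(3)] ne by metis
  qed
qed

section \<open>The space of infinite paths\<close>

lemma topspace_path_topology: "topspace (path_topology B) = inf_paths B"
proof -
  have "x \<in> cylinder B 1 1 x" if "x \<in> inf_paths B" for x
    using that by (simp add: cylinder_def)
  then have "\<Union> {cylinder B m n p | m n p. 1 \<le> m \<and> m \<le> n} = inf_paths B"
    by (auto simp: cylinder_def)
  then show ?thesis by (simp add: path_topology_def topology_generated_by_topspace)
qed

lemma openin_cylinder: "1 \<le> m \<Longrightarrow> m \<le> n \<Longrightarrow> openin (path_topology B) (cylinder B m n p)"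
  unfolding path_topology_def by (rule topology_generated_by_Basis) blast

lemma initial_cylinder_nbhd:
  assumes "openin (path_topology B) U" "x \<in> U"
  shows "\<exists>k. cylinder B 1 k x \<subseteq> U"
proof -
  have "generate_topology_on {cylinder B m n p | m n p. 1 \<le> m \<and> m \<le> n} U"
    using openin_topology_generated_by assms(1) unfolding path_topology_def by blast
  then show ?thesis using assms(2)
  proof (induction arbitrary: x)
    case (Int S T)
    then obtain k l where "cylinder B 1 k x \<subseteq> S" "cylinder B 1 l x \<subseteq> T" by blast
    moreover have "cylinder B 1 (max k l) x \<subseteq> cylinder B 1 k x \<inter> cylinder B 1 l x"
      by (auto simp: cylinder_def)
    ultimately show ?case by blast
  next
    case (UN \<K>)
    then show ?case by blast
  next
    case (Basis S)
    then obtain m n p where "S = cylinder B m n p" "1 \<le> m" by blast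
    then have "cylinder B 1 n x \<subseteq> S" using Basis.prems by (auto simp: cylinder_def)
    then show ?case by blast
  qed simp
qed

text \<open>The path space is a closed subset of the product of the finite discrete spaces of edges, hence
  compact in the product topology, and cylinders are open in that topology.\<close>

lemma compact_inf_paths: "compactin (path_topology B) (inf_paths B)"
proof -
  let ?P = "product_topology (\<lambda>i. discrete_topology (edges_at B i)) {1..}"
  let ?S = "subtopology ?P (inf_paths B)"
  have top: "topspace ?P = (\<Pi>\<^sub>E i\<in>{1..}. edges_at B i)" by simp
  have compP: "compact_space ?P"
    using diagram by (auto simp: compact_space_product_topology compact_space_discrete_topology
        bratteli_diagram_def)
  have closed: "closedin ?P (inf_paths B)"
  proof -
    have cont: "continuous_map ?P (discrete_topology UNIV) (\<lambda>x. h (x i))" if "1 \<le> i" for i and h :: "'e \<Rightarrow> 'v"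
    proof -
      have "continuous_map ?P (discrete_topology (edges_at B i)) (\<lambda>x. x i)"
        using that by (intro continuous_map_product_projection) simp
      moreover have "continuous_map (discrete_topology (edges_at B i)) (discrete_topology UNIV) h"
        by simp
      ultimately have "continuous_map ?P (discrete_topology UNIV) (h \<circ> (\<lambda>x. x i))"
        by (rule continuous_map_compose)
      then show ?thesis by (simp add: comp_def)
    qed
    have "closedin ?P {x \<in> topspace ?P. rng B (x i) = src B (x (i + 1))}" if "1 \<le> i" for i
      using closedin_continuous_maps_eq[OF Hausdorff_space_discrete_topology
          cont[of i "rng B"] cont[of "i + 1" "src B"]] that by simp
    then have "closedin ?P (\<Inter>i\<in>{1..}. {x \<in> topspace ?P. rng B (x i) = src B (x (i + 1))})"
      by (intro closedin_Inter) auto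
    also have "(\<Inter>i\<in>{1..}. {x \<in> topspace ?P. rng B (x i) = src B (x (i + 1))}) = inf_paths B"
      unfolding inf_paths_def top by (auto simp: PiE_def)
    finally show ?thesis .
  qed
  have compS: "compactin ?P (inf_paths B)"
    using closedin_compact_space[OF compP closed] .
  have sub: "inf_paths B \<subseteq> topspace ?P" using closedin_subset[OF closed] .
  have "continuous_map ?S (path_topology B) id"
    unfolding path_topology_def
  proof (rule continuous_on_generated_topo)
    fix U assume "U \<in> {cylinder B m n p | m n p. 1 \<le> m \<and> m \<le> n}"
    then obtain m n p where U: "U = cylinder B m n p" "1 \<le> m" "m \<le> n" by blast
    let ?T = "PiE {1..} (\<lambda>i. if i \<in> {m..n} then {p i} \<inter> edges_at B i else edges_at B i)"
    have "openin ?P ?T"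
      unfolding openin_PiE_gen
    proof (intro disjI2 conjI ballI)
      show "finite {i \<in> {1..}. (if i \<in> {m..n} then {p i} \<inter> edges_at B i else edges_at B i)
          \<noteq> topspace (discrete_topology (edges_at B i))}"
        by (rule finite_subset[of _ "{m..n}"]) auto
    qed auto
    moreover have "id -` U \<inter> topspace ?S = ?T \<inter> inf_paths B"
    proof -
      have "x \<in> ?T" if "x \<in> U" for x
      proof (rule PiE_I)
        have x: "x \<in> (\<Pi>\<^sub>E i\<in>{1..}. edges_at B i)" and xp: "\<And>i. i \<in> {m..n} \<Longrightarrow> x i = p i"
          using that U by (auto simp: cylinder_def inf_paths_def)
        show "x i \<in> (if i \<in> {m..n} then {p i} \<inter> edges_at B i else edges_at B i)" if "i \<in> {1..}" for i
          using PiE_mem[OF x that] xp[of i] by (cases "i \<in> {m..n}") auto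
        show "x i = undefined" if "i \<notin> {1..}" for i using PiE_arb[OF x that] .
      qed
      moreover have "x \<in> U" if "x \<in> ?T" "x \<in> inf_paths B" for x
      proof -
        have "x i = p i" if "i \<in> {m..n}" for i
          using PiE_mem[OF \<open>x \<in> ?T\<close>, of i] that U(2) by auto
        then show ?thesis using that U(1) by (auto simp: cylinder_def)
      qed
      moreover have "U \<subseteq> inf_paths B" using U by (auto simp: cylinder_def)
      moreover have "topspace ?S = inf_paths B" using sub by auto
      ultimately show ?thesis by auto
    qed
    ultimately show "openin ?S (id -` U \<inter> topspace ?S)" by (auto simp: openin_subtopology)
  next
    have "topspace ?S = inf_paths B" using sub by auto
    then show "id ` topspace ?S \<subseteq> \<Union> {cylinder B m n p | m n p. 1 \<le> m \<and> m \<le> n}"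
      using topspace_path_topology unfolding path_topology_def topology_generated_by_topspace by simp
  qed
  moreover have "compactin ?S (inf_paths B)" using compS by (simp add: compactin_subtopology)
  ultimately have "compactin (path_topology B) (id ` inf_paths B)" by (rule image_compactin[rotated])
  then show ?thesis by simp
qed

text \<open>A form of uniform continuity: by compactness one number \<open>K\<close> of initial edges of \<open>x\<close> suffices
  to determine the edge of \<open>\<phi> x\<close> at level \<open>N\<close>.\<close>

lemma continuous_map_uniform_head:
  assumes cont: "continuous_map (path_topology B) (path_topology B) \<phi>" and "1 \<le> N"
  obtains K where "N \<le> K"
    "\<And>x y. x \<in> inf_paths B \<Longrightarrow> y \<in> inf_paths B \<Longrightarrow> (\<And>i. 1 \<le> i \<Longrightarrow> i \<le> K \<Longrightarrow> x i = y i)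
       \<Longrightarrow> \<phi> x N = \<phi> y N"
proof -
  have into: "\<phi> x \<in> inf_paths B" if "x \<in> inf_paths B" for x
    using cont that by (auto simp: continuous_map_def topspace_path_topology)
  have "\<forall>x\<in>inf_paths B. \<exists>k. \<forall>y\<in>cylinder B 1 k x. \<phi> y N = \<phi> x N"
  proof
    fix x assume x: "x \<in> inf_paths B"
    have "openin (path_topology B) {y \<in> topspace (path_topology B). \<phi> y \<in> cylinder B N N (\<phi> x)}"
      using \<open>1 \<le> N\<close> by (intro openin_continuous_map_preimage[OF cont] openin_cylinder) auto
    moreover have "x \<in> {y \<in> topspace (path_topology B). \<phi> y \<in> cylinder B N N (\<phi> x)}"
      using x into by (simp add: topspace_path_topology cylinder_def)
    ultimately obtain k
      where "cylinder B 1 k x \<subseteq> {y \<in> topspace (path_topology B). \<phi> y \<in> cylinder B N N (\<phi> x)}"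
      using initial_cylinder_nbhd by blast
    then show "\<exists>k. \<forall>y\<in>cylinder B 1 k x. \<phi> y N = \<phi> x N" by (auto simp: cylinder_def)
  qed
  from bchoice[OF this] obtain k
    where k: "\<And>x y. x \<in> inf_paths B \<Longrightarrow> y \<in> cylinder B 1 (k x) x \<Longrightarrow> \<phi> y N = \<phi> x N"
    by blast
  \<comment> \<open>The successor keeps the interval of prescribed levels nonempty, as the basis of the topology
    requires.\<close>
  let ?C = "\<lambda>x. cylinder B 1 (Suc (k x)) x"
  have "openin (path_topology B) U" if "U \<in> ?C ` inf_paths B" for U
    using that by (auto intro: openin_cylinder)
  moreover have "inf_paths B \<subseteq> \<Union> (?C ` inf_paths B)"
    by (auto simp: cylinder_def)
  ultimately obtain T where "finite T" "T \<subseteq> ?C ` inf_paths B" and T: "inf_paths B \<subseteq> \<Union> T"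
    using compactinD[OF compact_inf_paths, of "?C ` inf_paths B"] by blast
  then obtain Z where Z: "finite Z" "Z \<subseteq> inf_paths B" "T = ?C ` Z"
    using finite_subset_image[of T ?C "inf_paths B"] by blast
  define K where "K = Max (insert N ((\<lambda>z. Suc (k z)) ` Z))"
  have Kz: "Suc (k z) \<le> K" if "z \<in> Z" for z
    using Z(1) that by (auto simp: K_def)
  have NK: "N \<le> K" using Z(1) by (auto simp: K_def)
  show ?thesis
  proof (rule that[OF NK])
    fix x y assume x: "x \<in> inf_paths B" and y: "y \<in> inf_paths B"
      and eq: "\<And>i. 1 \<le> i \<Longrightarrow> i \<le> K \<Longrightarrow> x i = y i"
    obtain z where z: "z \<in> Z" "x \<in> ?C z" using Z(3) T x by blast
    have "x \<in> cylinder B 1 (k z) z" "y \<in> cylinder B 1 (k z) z"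
      using z(2) y eq Kz[OF z(1)] by (auto simp: cylinder_def)
    then show "\<phi> x N = \<phi> y N" using k[of z] z(1) Z(2) by auto
  qed
qed

section \<open>The trace of a continuous Vershik map on edges\<close>

text \<open>The combinatorial trace of continuity. Let \<open>f\<close> be the immediate successor of \<open>e\<close> among the edges
  into a vertex of level \<open>n + 1\<close>, and let \<open>x\<close> be a path that reaches \<open>e\<close> along maximal edges. The
  successor map sends \<open>x\<close> to a path that reaches \<open>f\<close> along minimal edges. The first \<open>K\<close> edges of \<open>x\<close>
  are determined by the maximal ancestor of \<open>src B e\<close> at level \<open>K\<close>, and by uniform continuity they
  determine the minimal ancestor of \<open>src B f\<close> at level \<open>N\<close>. What matters is that neither \<open>K\<close> nor the
  function \<open>F\<close> depends on \<open>n\<close>.\<close>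

lemma vershik_map_factor:
  assumes \<omega>: "vertex_orders \<omega>" and vershik: "continuous_vershik_map B \<omega> \<phi>" and "1 \<le> N"
  obtains K F where "N \<le> K" "F \<in> verts_at B K \<rightarrow>\<^sub>E verts_at B N"
    "\<And>n u e f. K \<le> n \<Longrightarrow> u \<in> verts_at B (Suc n) \<Longrightarrow> covers (in_edges B u) (\<omega> u) e f \<Longrightarrow>
       F (max_ancestor B \<omega> (n - K) (src B e)) = min_ancestor B \<omega> (n - N) (src B f)"
proof -
  let ?g = "top_edge B \<omega>"
  have g: "edge_choice ?g" using edge_choice_top_edge[OF \<omega>] .
  have cont: "continuous_map (path_topology B) (path_topology B) \<phi>"
    and succ: "\<And>x. x \<in> inf_paths B - max_paths B \<omega> \<Longrightarrow> \<phi> x = succ_map B \<omega> x"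
    using vershik by (auto simp: continuous_vershik_map_def homeomorphic_imp_continuous_map)
  have into: "\<phi> x \<in> inf_paths B" if "x \<in> inf_paths B" for x
    using cont that by (auto simp: continuous_map_def topspace_path_topology)
  obtain K where "N \<le> K" and K: "\<And>x y. x \<in> inf_paths B \<Longrightarrow> y \<in> inf_paths B
      \<Longrightarrow> (\<And>i. 1 \<le> i \<Longrightarrow> i \<le> K \<Longrightarrow> x i = y i) \<Longrightarrow> \<phi> x N = \<phi> y N"
    using continuous_map_uniform_head[OF cont \<open>1 \<le> N\<close>] by blast
  have "1 \<le> K" using \<open>1 \<le> N\<close> \<open>N \<le> K\<close> by simp
  have "\<forall>t\<in>verts_at B K. \<exists>z. z \<in> inf_paths B \<and>
      (\<forall>i. 1 \<le> i \<and> i \<le> K \<longrightarrow> z i = ?g (back_vertex B ?g (K - i) t))"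
  proof
    fix t assume t: "t \<in> verts_at B K"
    obtain z where "z \<in> inf_paths B"
      "\<And>i. 1 \<le> i \<Longrightarrow> i \<le> K \<Longrightarrow> z i = ?g (back_vertex B ?g (K - i) t)"
      by (rule extend_to_inf_path[OF \<open>1 \<le> K\<close>, of "\<lambda>i. ?g (back_vertex B ?g (K - i) t)"])
        (use back_edge[OF g t] back_edge_src in auto)
    then show "\<exists>z. z \<in> inf_paths B \<and>
        (\<forall>i. 1 \<le> i \<and> i \<le> K \<longrightarrow> z i = ?g (back_vertex B ?g (K - i) t))" by blast
  qed
  from bchoice[OF this] obtain z where z: "\<And>t. t \<in> verts_at B K \<Longrightarrow> z t \<in> inf_paths B"
    "\<And>t i. t \<in> verts_at B K \<Longrightarrow> 1 \<le> i \<Longrightarrow> i \<le> K \<Longrightarrow> z t i = ?g (back_vertex B ?g (K - i) t)"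
    by blast
  \<comment> \<open>The path \<open>z t\<close> begins with the maximal path to \<open>t\<close>; its continuation is arbitrary.\<close>
  define F where "F = (\<lambda>t\<in>verts_at B K. rng B (\<phi> (z t) N))"
  have "rng B (\<phi> (z t) N) \<in> verts_at B N" if "t \<in> verts_at B K" for t
  proof -
    have "\<phi> (z t) N \<in> edges_at B (Suc (N - 1))"
      using into[OF z(1)[OF that]] \<open>1 \<le> N\<close> by (auto simp: inf_paths_def)
    then show ?thesis using rng_in \<open>1 \<le> N\<close> by fastforce
  qed
  then have "F \<in> verts_at B K \<rightarrow>\<^sub>E verts_at B N" by (auto simp: F_def)
  then show ?thesis
  proof (rule that[OF \<open>N \<le> K\<close>])
    fix n u e f
    assume "K \<le> n" and u: "u \<in> verts_at B (Suc n)" and cov: "covers (in_edges B u) (\<omega> u) e f"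
    have lin: "linear_order_on (in_edges B u) (\<omega> u)" using \<omega> u by (auto simp: vertex_orders_def)
    note L = linear_order_onD[OF lin]
    have ef: "f \<noteq> e" "(e, f) \<in> \<omega> u" "e \<in> in_edges B u" "f \<in> in_edges B u"
      using cov L(5) by (auto simp: covers_def)
    have e: "e \<in> edges_at B (Suc n)" "rng B e = u" and f: "f \<in> edges_at B (Suc n)" "rng B f = u"
      using ef in_edges_eq[OF u] by auto
    have se: "src B e \<in> verts_at B n" and sf: "src B f \<in> verts_at B n" using src_in e f by auto
    have "\<not> max_edge B \<omega> e" using ef e L(3) by (auto simp: max_edge_def)
    have succ_e: "succ_edge B \<omega> e = f"
      unfolding succ_edge_def e(2)
    proof (rule the_equality)
      show "f \<in> in_edges B u \<and> f \<noteq> e \<and> (e, f) \<in> \<omega> u \<and>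
          (\<forall>g\<in>in_edges B u. g \<noteq> e \<and> (e, g) \<in> \<omega> u \<longrightarrow> (f, g) \<in> \<omega> u)"
        using cov by (simp add: covers_def)
    next
      fix h assume "h \<in> in_edges B u \<and> h \<noteq> e \<and> (e, h) \<in> \<omega> u \<and>
          (\<forall>g\<in>in_edges B u. g \<noteq> e \<and> (e, g) \<in> \<omega> u \<longrightarrow> (h, g) \<in> \<omega> u)"
      then show "h = f" using cov L(3) by (simp add: covers_def)
    qed
    define p where "p i = (if i \<le> n then ?g (back_vertex B ?g (n - i) (src B e)) else e)" for i
    obtain x where x: "x \<in> inf_paths B" and xp: "\<And>i. 1 \<le> i \<Longrightarrow> i \<le> Suc n \<Longrightarrow> x i = p i"
    proof (rule extend_to_inf_path[of "Suc n" p])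
      fix i :: nat assume i: "1 \<le> i" "i \<le> Suc n"
      then show "p i \<in> edges_at B i"
        using back_edge(1)[OF g se i(1)] e(1) by (cases "i = Suc n") (auto simp: p_def)
    next
      fix i :: nat assume i: "1 \<le> i" "i < Suc n"
      then show "rng B (p i) = src B (p (i + 1))"
        using back_edge(2)[OF g se i(1)] by (cases "i = n") (auto simp: p_def back_edge_src)
    qed auto
    have xe: "x (Suc n) = e" using xp[of "Suc n"] by (simp add: p_def)
    have max_below: "max_edge B \<omega> (x i)" if "1 \<le> i" "i \<le> n" for i
    proof -
      have "p i \<in> edges_at B i" "p i = ?g (rng B (p i))"
        using back_edge[OF g se that] that by (simp_all add: p_def)
      then show ?thesis using max_edge_iff[OF \<omega>, of "p i" i] xp[of i] that by simp
    qed
    have least: "(LEAST i. 1 \<le> i \<and> \<not> max_edge B \<omega> (x i)) = Suc n"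
      using max_below xe \<open>\<not> max_edge B \<omega> e\<close>
      by (intro Least_equality) (auto simp: not_less_eq_eq[symmetric])
    have "x \<notin> max_paths B \<omega>" using xe \<open>\<not> max_edge B \<omega> e\<close> by (force simp: max_paths_def)
    then have "\<phi> x N = min_path_to B \<omega> n (src B f) N"
      using succ[of x] x \<open>1 \<le> N\<close> \<open>N \<le> K\<close> \<open>K \<le> n\<close> unfolding succ_map_def least Let_def
      by (simp add: xe succ_e)
    then have "rng B (\<phi> x N) = min_ancestor B \<omega> (n - N) (src B f)"
      using min_path_to_rng[OF \<omega> sf \<open>1 \<le> N\<close>] \<open>N \<le> K\<close> \<open>K \<le> n\<close> by simp
    moreover have "\<phi> x N = \<phi> (z (back_vertex B ?g (n - K) (src B e))) N"
    proof (rule K[OF x])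
      have t: "back_vertex B ?g (n - K) (src B e) \<in> verts_at B K"
        using back_vertex_in[OF g se, of "n - K"] \<open>K \<le> n\<close> by simp
      then show "z (back_vertex B ?g (n - K) (src B e)) \<in> inf_paths B" by (rule z(1))
      fix i assume "1 \<le> i" "i \<le> K"
      then show "x i = z (back_vertex B ?g (n - K) (src B e)) i"
        using z(2)[OF t] xp[of i] \<open>K \<le> n\<close> by (simp add: p_def back_vertex_add)
    qed
    moreover have "back_vertex B ?g (n - K) (src B e) \<in> verts_at B K"
      using back_vertex_in[OF g se, of "n - K"] \<open>K \<le> n\<close> by simp
    ultimately show "F (max_ancestor B \<omega> (n - K) (src B e)) = min_ancestor B \<omega> (n - N) (src B f)"
      by (simp add: F_def)
  qed
qed

end

section \<open>Compatible orders are rare\<close>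

text \<open>The orders at a vertex \<open>u\<close> of level \<open>n + 1\<close> that are possible next to the orders \<open>\<omega>\<close> at lower
  levels when \<open>F\<close> comes from a continuous Vershik map and two minimal paths have separated by level
  \<open>N\<close>. Only the values of \<open>\<omega>\<close> at the levels from 1 to \<open>n\<close> enter, so the order at \<open>u\<close> itself is
  independent of this set.\<close>

definition compatible_orders ::
    "('v, 'e) bratteli \<Rightarrow> nat \<Rightarrow> nat \<Rightarrow> nat \<Rightarrow> ('v \<Rightarrow> 'v) \<Rightarrow> 'v \<Rightarrow> ('v \<Rightarrow> 'e rel) \<Rightarrow> 'e rel set" where
  "compatible_orders B N K n F u \<omega> = {R \<in> linear_orders_at B u.
     (\<exists>w\<in>verts_at B n. \<exists>w'\<in>verts_at B n.
        min_ancestor B \<omega> (n - N) w \<noteq> min_ancestor B \<omega> (n - N) w') \<and>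
     (\<forall>e f. covers (in_edges B u) R e f \<longrightarrow>
        F (max_ancestor B \<omega> (n - K) (src B e)) = min_ancestor B \<omega> (n - N) (src B f))}"

context diagram
begin

lemma back_vertex_cong:
  assumes "edge_choice g" "w \<in> verts_at B n" "d \<le> n"
    and "\<And>v i. v \<in> verts_at B i \<Longrightarrow> 1 \<le> i \<Longrightarrow> i \<le> n \<Longrightarrow> h v = g v"
  shows "back_vertex B h d w = back_vertex B g d w"
  using assms(3)
proof (induction d)
  case (Suc d)
  then have "back_vertex B g d w \<in> verts_at B (n - d)"
    using back_vertex_in[OF assms(1,2)] by simp
  then have "h (back_vertex B g d w) = g (back_vertex B g d w)"
    using assms(4) Suc.prems by simp
  then show ?case using Suc by (simp add: back_vertex_Suc)
qed simp

lemma compatible_orders_restrict: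
  assumes "vertex_orders \<omega>" "u \<in> verts_at B (Suc n)"
  shows "compatible_orders B N K n F u (restrict \<omega> (\<Union>i\<in>{1..n}. verts_at B i))
    = compatible_orders B N K n F u \<omega>"
proof -
  let ?J = "\<Union>i\<in>{1..n}. verts_at B i"
  have "max_ancestor B (restrict \<omega> ?J) (n - k) w = max_ancestor B \<omega> (n - k) w"
    and "min_ancestor B (restrict \<omega> ?J) (n - k) w = min_ancestor B \<omega> (n - k) w"
    if "w \<in> verts_at B n" for k w
    using assms(1) that
    by (auto intro!: back_vertex_cong edge_choice_top_edge vertex_orders_reverse
        simp: top_edge_def reverse_order_def)
  moreover have "src B e \<in> verts_at B n" "src B f \<in> verts_at B n"
    if "R \<in> linear_orders_at B u" "covers (in_edges B u) R e f" for R e f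
  proof -
    have "linear_order_on (in_edges B u) R" using that(1) by (simp add: linear_orders_at_def)
    then have "e \<in> in_edges B u \<and> f \<in> in_edges B u"
      using that(2) linear_order_onD(5) by (fastforce simp: covers_def)
    then show "src B e \<in> verts_at B n" "src B f \<in> verts_at B n"
      using in_edges_eq[OF assms(2)] src_in by auto
  qed
  ultimately show ?thesis
    unfolding compatible_orders_def by (intro Collect_cong conj_cong bex_cong all_cong1 refl) auto
qed

lemma finite_linear_orders_at: "finite (linear_orders_at B v)"
  unfolding linear_orders_at_def by (rule finite_linear_orders[OF finite_in_edges])

lemma linear_orders_at_nonempty: "linear_orders_at B v \<noteq> {}"
  using well_order_on[of "in_edges B v"] by (auto simp: linear_orders_at_def well_order_on_def)

lemma src_image_in_edges:
  assumes "completely_connected B" "u \<in> verts_at B (Suc n)"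
  shows "src B ` in_edges B u = verts_at B n"
proof
  show "src B ` in_edges B u \<subseteq> verts_at B n" using in_edges_eq[OF assms(2)] src_in by auto
  show "verts_at B n \<subseteq> src B ` in_edges B u"
  proof
    fix w assume "w \<in> verts_at B n"
    then have "incidence B n u w > 0" using assms by (simp add: completely_connected_def)
    then have "{e \<in> edges_at B (n + 1). rng B e = u \<and> src B e = w} \<noteq> {}"
      unfolding incidence_def by (metis card.empty less_irrefl)
    then show "w \<in> src B ` in_edges B u" using in_edges_eq[OF assms(2)] by auto
  qed
qed

text \<open>As the diagram is completely connected, the edges into \<open>u\<close> have all vertices of level \<open>n\<close> as
  sources. So there are at least \<open>card (verts_at B n)\<close> of them, and they carry all the minimal
  ancestors that occur.\<close>

lemma card_compatible_orders_le:
  assumes "completely_connected B" "u \<in> verts_at B (Suc n)"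
  shows "card (verts_at B n) * card (compatible_orders B N K n F u \<omega>)
    \<le> 3 * card (linear_orders_at B u)"
proof (cases "\<exists>w\<in>verts_at B n. \<exists>w'\<in>verts_at B n.
        min_ancestor B \<omega> (n - N) w \<noteq> min_ancestor B \<omega> (n - N) w'")
  case False
  then have "compatible_orders B N K n F u \<omega> = {}" unfolding compatible_orders_def by blast
  then show ?thesis by simp
next
  case True
  let ?f = "\<lambda>e. F (max_ancestor B \<omega> (n - K) (src B e))"
  let ?b = "\<lambda>e. min_ancestor B \<omega> (n - N) (src B e)"
  have "compatible_orders B N K n F u \<omega> =
      {R. linear_order_on (in_edges B u) R \<and> (\<forall>e f. covers (in_edges B u) R e f \<longrightarrow> ?f e = ?b f)}"
    using True unfolding compatible_orders_def linear_orders_at_def by blast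
  moreover have "\<exists>x\<in>in_edges B u. \<exists>y\<in>in_edges B u. ?b x \<noteq> ?b y"
    using True unfolding src_image_in_edges[OF assms, symmetric] by blast
  then have "card (in_edges B u) *
      card {R. linear_order_on (in_edges B u) R \<and> (\<forall>e f. covers (in_edges B u) R e f \<longrightarrow> ?f e = ?b f)}
    \<le> 3 * card (linear_orders_at B u)"
    unfolding linear_orders_at_def by (rule card_compatible_linear_orders_le[OF finite_in_edges])
  moreover have "card (verts_at B n) \<le> card (in_edges B u)"
    using card_image_le[OF finite_in_edges, of "src B" u] src_image_in_edges[OF assms] by simp
  ultimately show ?thesis by (metis mult_le_mono1 order_trans)
qed

abbreviation order_product :: "('v \<Rightarrow> 'e rel) measure" where
  "order_product \<equiv> \<Pi>\<^sub>M v\<in>all_verts B - verts_at B 0. uniform_count_measure (linear_orders_at B v)"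

lemma product_prob_space_orders:
  "product_prob_space (\<lambda>v. uniform_count_measure (linear_orders_at B v))"
proof -
  have p: "prob_space (uniform_count_measure (linear_orders_at B v))" for v
    by (rule prob_space_uniform_count_measure[OF finite_linear_orders_at linear_orders_at_nonempty])
  show ?thesis
    by (intro product_prob_space.intro product_sigma_finite.intro product_prob_space_axioms.intro p
        prob_space_imp_sigma_finite)
qed

lemma space_order_product: "space order_product = order_set B"
  by (simp add: space_PiM order_set_def space_uniform_count_measure)

lemma compatible_event_small:
  assumes cc: "completely_connected B" and u: "u \<in> verts_at B (Suc n)"
  shows "{\<omega> \<in> space order_product. \<omega> u \<in> compatible_orders B N K n F u \<omega>} \<in> sets order_product"
    and "emeasure order_product {\<omega> \<in> space order_product. \<omega> u \<in> compatible_orders B N K n F u \<omega>}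
      \<le> ennreal (3 / card (verts_at B n))"
proof -
  let ?J = "\<Union>i\<in>{1..n}. verts_at B i"
  let ?L = "linear_orders_at B u"
  interpret product_prob_space "\<lambda>v. uniform_count_measure (linear_orders_at B v)"
      "all_verts B - verts_at B 0"
    by (rule product_prob_space_orders)
  have J: "finite ?J" "?J \<subseteq> all_verts B - verts_at B 0"
  proof -
    show "finite ?J" using finite_verts by blast
    show "?J \<subseteq> all_verts B - verts_at B 0"
    proof
      fix v assume "v \<in> ?J"
      then obtain i where "1 \<le> i" "v \<in> verts_at B i" by auto
      then have "v \<in> verts_at B (Suc (i - 1))" by simp
      then show "v \<in> all_verts B - verts_at B 0" using nonroot_iff by blast
    qed
  qed
  have u': "u \<in> all_verts B - verts_at B 0" "u \<notin> ?J"
    using u nonroot_iff by (blast, auto dest: level_unique[OF u])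
  have sub: "compatible_orders B N K n F u \<tau> \<subseteq> ?L" for \<tau>
    by (auto simp: compatible_orders_def)
  have "verts_at B n \<noteq> {}"
    using src_image_in_edges[OF cc u] in_edges_nonempty[OF u] by blast
  then have pos: "0 < card (verts_at B n)" using finite_verts by (simp add: card_gt_0_iff)
  have small: "emeasure (uniform_count_measure ?L) (compatible_orders B N K n F u \<tau>)
      \<le> ennreal (3 / card (verts_at B n))" for \<tau>
  proof -
    have "0 < card ?L"
      using finite_linear_orders_at linear_orders_at_nonempty by (simp add: card_gt_0_iff)
    moreover have "real (card (verts_at B n)) * real (card (compatible_orders B N K n F u \<tau>))
        \<le> 3 * real (card ?L)"
      using card_compatible_orders_le[OF cc u, of N K F \<tau>]
      by (metis of_nat_le_iff of_nat_mult of_nat_numeral)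
    ultimately have "real (card (compatible_orders B N K n F u \<tau>)) / real (card ?L)
        \<le> 3 / card (verts_at B n)"
      using pos by (simp add: field_simps)
    then show ?thesis
      by (simp add: emeasure_uniform_count_measure[OF finite_linear_orders_at sub] ennreal_leI)
  qed
  have local: "compatible_orders B N K n F u (restrict \<omega> ?J) = compatible_orders B N K n F u \<omega>"
    if "\<omega> \<in> space order_product" for \<omega>
    using compatible_orders_restrict[OF vertex_orders_of_order_set u] that space_order_product by blast
  note small_event = emeasure_conditionally_small[where S = "linear_orders_at B"
      and H = "compatible_orders B N K n F u", OF refl finite_linear_orders_at J u' sub small local]
  show "{\<omega> \<in> space order_product. \<omega> u \<in> compatible_orders B N K n F u \<omega>} \<in> sets order_product"
    by (rule small_event(1))
  show "emeasure order_product {\<omega> \<in> space order_product. \<omega> u \<in> compatible_orders B N K n F u \<omega>}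
      \<le> ennreal (3 / card (verts_at B n))"
    by (rule small_event(2))
qed

text \<open>The levels with many vertices occur arbitrarily late, since the finitely many levels before \<open>K\<close>
  are bounded in size.\<close>

lemma infinite_rank_unbounded:
  assumes "infinite_rank B"
  obtains n where "K \<le> n" "k < card (verts_at B n)"
proof -
  obtain n where n: "k + (\<Sum>i\<le>K. card (verts_at B i)) < card (verts_at B n)"
    using assms unfolding infinite_rank_def finite_rank_def by (meson not_le)
  have "K \<le> n"
  proof (rule ccontr)
    assume "\<not> K \<le> n"
    then have "card (verts_at B n) \<le> (\<Sum>i\<le>K. card (verts_at B i))"
      by (intro member_le_sum) auto
    then show False using n by simp
  qed
  then show ?thesis using that n by simp
qed

text \<open>For fixed \<open>N\<close> and \<open>K\<close> the number of candidates \<open>F\<close> does not depend on \<open>n\<close>. Hence the event at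
  level \<open>n\<close> has probability at most a constant divided by \<open>card (verts_at B n)\<close>, which is arbitrarily
  small for suitable \<open>n\<close>.\<close>

lemma AE_not_always_compatible:
  assumes cc: "completely_connected B" and ir: "infinite_rank B"
  shows "AE \<omega> in order_product. \<not> (\<exists>F\<in>verts_at B K \<rightarrow>\<^sub>E verts_at B N. \<forall>n\<ge>K. \<forall>u\<in>verts_at B (Suc n).
    \<omega> u \<in> compatible_orders B N K n F u \<omega>)"
proof -
  interpret product_prob_space "\<lambda>v. uniform_count_measure (linear_orders_at B v)"
      "all_verts B - verts_at B 0"
    by (rule product_prob_space_orders)
  let ?\<F> = "verts_at B K \<rightarrow>\<^sub>E verts_at B N"
  have fin\<F>: "finite ?\<F>" by (intro finite_PiE finite_verts)
  have "\<exists>u. u \<in> verts_at B (Suc n)" for n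
  proof (induction n)
    case 0
    obtain v where "verts_at B 0 = {v}" using diagram by (auto simp: bratteli_diagram_def)
    then obtain e where "e \<in> edges_at B (Suc 0)" using src_rng_image(1)[of 0] by blast
    then show ?case using rng_in by blast
  next
    case (Suc n)
    then obtain e where "e \<in> edges_at B (Suc (Suc n))" using src_rng_image(1)[of "Suc n"] by blast
    then show ?case using rng_in by blast
  qed
  then obtain u where u: "\<And>n. u n \<in> verts_at B (Suc n)" by metis
  define A where "A n F = {\<omega> \<in> space order_product. \<omega> (u n) \<in> compatible_orders B N K n F (u n) \<omega>}"
    for n F
  define Z where "Z = (\<Inter>n\<in>{K..}. \<Union>F\<in>?\<F>. A n F)"
  have A: "A n F \<in> sets order_product" "emeasure order_product (A n F) \<le> ennreal (3 / card (verts_at B n))"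
    for n F
    unfolding A_def using compatible_event_small[OF cc u] by blast+
  have UA: "(\<Union>F\<in>?\<F>. A n F) \<in> sets order_product" for n
    using fin\<F> A(1) by (intro sets.finite_UN) auto
  have Z: "Z \<in> sets order_product"
    unfolding Z_def using UA by (intro sets.countable_INT') auto
  have bound: "P.prob Z \<le> card ?\<F> * (3 / card (verts_at B n))" if "K \<le> n" for n
  proof -
    have "emeasure order_product Z \<le> emeasure order_product (\<Union>F\<in>?\<F>. A n F)"
      using UA that by (intro emeasure_mono) (auto simp: Z_def)
    also have "\<dots> \<le> (\<Sum>F\<in>?\<F>. emeasure order_product (A n F))"
      using fin\<F> A(1) by (intro emeasure_subadditive_finite) auto
    also have "\<dots> \<le> (\<Sum>F\<in>?\<F>. ennreal (3 / card (verts_at B n)))" by (intro sum_mono A(2))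
    also have "\<dots> = ennreal (card ?\<F> * (3 / card (verts_at B n)))"
      by (subst sum_ennreal) simp_all
    finally show ?thesis by (simp add: P.emeasure_eq_measure)
  qed
  have "P.prob Z = 0"
  proof (rule ccontr)
    assume "P.prob Z \<noteq> 0"
    then have pos: "0 < P.prob Z" using measure_nonneg[of order_product Z] by linarith
    obtain k :: nat where k: "3 * card ?\<F> / P.prob Z < k" using reals_Archimedean2 by blast
    obtain n where n: "K \<le> n" "k < card (verts_at B n)" using infinite_rank_unbounded[OF ir] .
    then have "3 * card ?\<F> / P.prob Z < card (verts_at B n)" using k by linarith
    then have "card ?\<F> * (3 / card (verts_at B n)) < P.prob Z"
      using pos n(2) by (simp add: field_simps)
    then show False using bound[OF n(1)] by linarith
  qed
  then have "Z \<in> null_sets order_product" using Z by (auto simp: P.emeasure_eq_measure)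
  then show ?thesis
    by (rule AE_I') (use u in \<open>auto simp: Z_def A_def\<close>)
qed

lemma imperfect_of_not_compatible:
  assumes \<omega>: "\<omega> \<in> order_set B" and j: "ext_card (min_paths B \<omega>) > 1"
    and incompatible: "\<And>N K. \<not> (\<exists>F\<in>verts_at B K \<rightarrow>\<^sub>E verts_at B N. \<forall>n\<ge>K. \<forall>u\<in>verts_at B (Suc n).
      \<omega> u \<in> compatible_orders B N K n F u \<omega>)"
  shows "imperfect_order B \<omega>"
  unfolding imperfect_order_def perfect_order_def
proof
  assume "\<exists>\<phi>. continuous_vershik_map B \<omega> \<phi>"
  then obtain \<phi> where \<phi>: "continuous_vershik_map B \<omega> \<phi>" ..
  have vo: "vertex_orders \<omega>" by (rule vertex_orders_of_order_set[OF \<omega>])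
  have "\<exists>x\<in>min_paths B \<omega>. \<exists>y\<in>min_paths B \<omega>. x \<noteq> y"
  proof (rule ccontr)
    assume "\<not> ?thesis"
    then obtain a where "min_paths B \<omega> \<subseteq> {a}" by blast
    then have fin: "finite (min_paths B \<omega>)" and "card (min_paths B \<omega>) \<le> 1"
      using finite_subset card_mono[of "{a}" "min_paths B \<omega>"] by auto
    then show False using j fin by (simp add: ext_card_def one_enat_def)
  qed
  then obtain x y where xy: "x \<in> min_paths B \<omega>" "y \<in> min_paths B \<omega>" "x \<noteq> y" by blast
  obtain N where "1 \<le> N" and sep: "\<And>n. N \<le> n \<Longrightarrow> \<exists>w\<in>verts_at B n. \<exists>w'\<in>verts_at B n.
      min_ancestor B \<omega> (n - N) w \<noteq> min_ancestor B \<omega> (n - N) w'"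
    using two_min_paths_separate[OF vo xy] by blast
  obtain K F where "N \<le> K" and F: "F \<in> verts_at B K \<rightarrow>\<^sub>E verts_at B N"
    and factor: "\<And>n u e f. K \<le> n \<Longrightarrow> u \<in> verts_at B (Suc n) \<Longrightarrow> covers (in_edges B u) (\<omega> u) e f \<Longrightarrow>
       F (max_ancestor B \<omega> (n - K) (src B e)) = min_ancestor B \<omega> (n - N) (src B f)"
    using vershik_map_factor[OF vo \<phi> \<open>1 \<le> N\<close>] by blast
  have "\<omega> u \<in> compatible_orders B N K n F u \<omega>" if "K \<le> n" "u \<in> verts_at B (Suc n)" for n u
  proof -
    have "\<omega> u \<in> linear_orders_at B u"
      using vo that(2) by (auto simp: vertex_orders_def linear_orders_at_def)
    then show ?thesis
      using sep[of n] factor[OF that] \<open>N \<le> K\<close> that(1) unfolding compatible_orders_def by simp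
  qed
  then show False using incompatible F by blast
qed

end

theorem theorem3p3:
  fixes B :: "('v, 'e) bratteli" and j :: enat
  assumes "bratteli_diagram B"
    and "completely_connected B"
    and "infinite_rank B"
    and "AE \<omega> in order_measure B. ext_card (max_paths B \<omega>) = j \<and> ext_card (min_paths B \<omega>) = j"
    and "j > 1"
  shows "AE \<omega> in order_measure B. imperfect_order B \<omega>"
proof -
  interpret diagram B by (rule diagram.intro) (rule assms(1))
  have meas: "order_measure B = completion order_product"
    by (simp add: order_measure_def)
  have "AE \<omega> in order_product. \<forall>N K. \<not> (\<exists>F\<in>verts_at B K \<rightarrow>\<^sub>E verts_at B N.
      \<forall>n\<ge>K. \<forall>u\<in>verts_at B (Suc n). \<omega> u \<in> compatible_orders B N K n F u \<omega>)"
    unfolding AE_all_countable using AE_not_always_compatible[OF assms(2,3)] by blast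
  then have "AE \<omega> in order_measure B. \<forall>N K. \<not> (\<exists>F\<in>verts_at B K \<rightarrow>\<^sub>E verts_at B N.
      \<forall>n\<ge>K. \<forall>u\<in>verts_at B (Suc n). \<omega> u \<in> compatible_orders B N K n F u \<omega>)"
    unfolding meas by (rule AE_completion)
  with assms(4) AE_space show ?thesis
  proof eventually_elim
    case (elim \<omega>)
    have "\<omega> \<in> order_set B" using elim(2) space_order_product by (simp add: meas)
    moreover have "ext_card (min_paths B \<omega>) > 1" using elim(1) assms(5) by simp
    ultimately show ?case using elim(3) by (intro imperfect_of_not_compatible) blast+
  qed
qed

end
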